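(* Let $i\ge 1$. For each $i$-tuple of integers $\underline{\ell}=(l_1,\dots,l_i)$ with $1\le l_1<\cdots<l_i$, the class $x_{\underline{\ell}}\in H_i(SL_2(\mathbb{Z}[t]),\mathbb{Z})$ is nontrivial. Moreover, if $\underline{m}=(m_1,\dots,m_i)$ with $1\le m_1<\cdots<m_i$ is another such $i$-tuple distinct from $\underline{\ell}$, then $x_{\underline{\ell}}$ and $x_{\underline{m}}$ are distinct. Thus the group $H_i(SL_2(\mathbb{Z}[t]),\mathbb{Z})$ is not finitely generated for all $i\ge 1$.
   Context: For a commutative ring $A$, $E_2(A)$ denotes the subgroup of $GL_2(A)$ generated by the elementary matrices. Let $t\mathbb{Z}[t]$ be the additive group of polynomials with zero constant term; it is torsion-free, so $H_i(t\mathbb{Z}[t],\mathbb{Z})=\bigwedge^i_{\mathbb{Z}}t\mathbb{Z}[t]$ (via the Pontryagin product). The homomorphism $u:t\mathbb{Z}[t]\to E_2(\mathbb{Z}[t])$, $f\mapsto\begin{pmatrix}1&f\\0&1\end{pmatrix}$, induces a map $\bigwedge^i_{\mathbb{Z}}t\mathbb{Z}[t]\to H_i(E_2(\mathbb{Z}[t]),\mathbb{Z})$, and $t^{l_1}\wedge\cdots\wedge t^{l_i}$ also denotes the image of that element in $H_i(E_2(\mathbb{Z}[t]),\mathbb{Z})$. Let $j:E_2(\mathbb{Z}[t])\to SL_2(\mathbb{Z}[t])$ be the inclusion. The class $x_{\underline{\ell}}$ is defined by $x_{\underline{\ell}}=j_*(t^{l_1}\wedge\cdots\wedge t^{l_i})\in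 H_i(SL_2(\mathbb{Z}[t]),\mathbb{Z})$. *)

theory Defs
  imports
    "HOL-Analysis.Determinants"
    "HOL-Algebra.Free_Abelian_Groups"
    "HOL-Algebra.Generated_Groups"
    "HOL-Computational_Algebra.Polynomial"
begin

section \<open>Integral group homology\<close>

text \<open>
  \<open>H\<^sub>n(G, \<int>)\<close> is the homology of the inhomogeneous bar complex with trivial integer
  coefficients: \<open>C\<^sub>n\<close> is free abelian on the symbols \<open>[g\<^sub>1|\<dots>|g\<^sub>n]\<close>, represented by lists of
  length \<open>n\<close> over the carrier, and
  \<open>\<partial>[g\<^sub>1|\<dots>|g\<^sub>n] = [g\<^sub>2|\<dots>|g\<^sub>n] + \<Sum>\<^sub>0\<^sub><\<^sub>k\<^sub><\<^sub>n (-1)\<^sup>k [g\<^sub>1|\<dots>|g\<^sub>k g\<^sub>k\<^sub>+\<^sub>1|\<dots>|g\<^sub>n] + (-1)\<^sup>n [g\<^sub>1|\<dots>|g\<^sub>n\<^sub>-\<^sub>1]\<close>.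
\<close>

definition bar_chain_group :: "('a, 'b) monoid_scheme \<Rightarrow> nat \<Rightarrow> ('a list \<Rightarrow>\<^sub>0 int) monoid" where
  "bar_chain_group G n = free_Abelian_group {gs. length gs = n \<and> set gs \<subseteq> carrier G}"

definition bar_face :: "('a, 'b) monoid_scheme \<Rightarrow> nat \<Rightarrow> 'a list \<Rightarrow> 'a list" where
  "bar_face G k gs =
    (if k = 0 then tl gs
     else if k = length gs then butlast gs
     else take (k - 1) gs @ (gs ! (k - 1) \<otimes>\<^bsub>G\<^esub> gs ! k) # drop (k + 1) gs)"

definition bar_boundary :: "('a, 'b) monoid_scheme \<Rightarrow> ('a list \<Rightarrow>\<^sub>0 int) \<Rightarrow> ('a list \<Rightarrow>\<^sub>0 int)" where
  "bar_boundary G =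
    frag_extend (\<lambda>gs. if gs = [] then 0
      else (\<Sum>k\<le>length gs. frag_cmul ((-1) ^ k) (frag_of (bar_face G k gs))))"

definition bar_cycle_group :: "('a, 'b) monoid_scheme \<Rightarrow> nat \<Rightarrow> ('a list \<Rightarrow>\<^sub>0 int) monoid" where
  "bar_cycle_group G n =
    (bar_chain_group G n)
      \<lparr>carrier := {c \<in> carrier (bar_chain_group G n). bar_boundary G c = 0}\<rparr>"

definition bar_boundaries :: "('a, 'b) monoid_scheme \<Rightarrow> nat \<Rightarrow> ('a list \<Rightarrow>\<^sub>0 int) set" where
  "bar_boundaries G n = bar_boundary G ` carrier (bar_chain_group G (Suc n))"

definition group_homology ::
    "('a, 'b) monoid_scheme \<Rightarrow> nat \<Rightarrow> ('a list \<Rightarrow>\<^sub>0 int) set monoid" where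
  "group_homology G n = bar_cycle_group G n Mod bar_boundaries G n"

definition homology_class ::
    "('a, 'b) monoid_scheme \<Rightarrow> nat \<Rightarrow> ('a list \<Rightarrow>\<^sub>0 int) \<Rightarrow> ('a list \<Rightarrow>\<^sub>0 int) set" where
  "homology_class G n z = bar_boundaries G n #>\<^bsub>bar_cycle_group G n\<^esub> z"

definition bar_chain_map :: "('a \<Rightarrow> 'c) \<Rightarrow> ('a list \<Rightarrow>\<^sub>0 int) \<Rightarrow> ('c list \<Rightarrow>\<^sub>0 int)" where
  "bar_chain_map f = frag_extend (\<lambda>gs. frag_of (map f gs))"

text \<open>
  The map \<open>f\<^sub>*\<close> into the homology of \<open>H\<close> induced by a group homomorphism \<open>f\<close> with target \<open>H\<close>.
  Homology classes are cosets of cycles, and all cycles in a coset have homologous images.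
\<close>

definition homology_induced ::
    "('c, 'd) monoid_scheme \<Rightarrow> nat \<Rightarrow> ('a \<Rightarrow> 'c) \<Rightarrow> ('a list \<Rightarrow>\<^sub>0 int) set \<Rightarrow> ('c list \<Rightarrow>\<^sub>0 int) set" where
  "homology_induced H n f c = the_elem ((\<lambda>z. homology_class H n (bar_chain_map f z)) ` c)"


section \<open>The Pontryagin product\<close>

text \<open>
  For a commutative group the multiplication is a homomorphism, and the Pontryagin product is the
  composite of the homology cross product with the map it induces. On the bar complex it is given
  by the Eilenberg-Zilber shuffle formula
  \<open>[a\<^sub>1|\<dots>|a\<^sub>p] \<cdot> [a\<^sub>p\<^sub>+\<^sub>1|\<dots>|a\<^sub>p\<^sub>+\<^sub>q] = \<Sum>\<^sub>\<sigma> sgn(\<sigma>) [a\<^sub>\<sigma>\<^sub>(\<^sub>1\<^sub>)|\<dots>|a\<^sub>\<sigma>\<^sub>(\<^sub>p\<^sub>+\<^sub>q\<^sub>)]\<close>, the sum being over the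
  \<open>(p, q)\<close>-shuffles; the recursion below sorts the shuffles by their first letter.
\<close>

fun bar_shuffle :: "'a list \<Rightarrow> 'a list \<Rightarrow> ('a list \<Rightarrow>\<^sub>0 int)" where
  "bar_shuffle [] bs = frag_of bs"
| "bar_shuffle (a # as) [] = frag_of (a # as)"
| "bar_shuffle (a # as) (b # bs) =
     frag_extend (\<lambda>cs. frag_of (a # cs)) (bar_shuffle as (b # bs)) +
     frag_cmul ((-1) ^ length (a # as))
       (frag_extend (\<lambda>cs. frag_of (b # cs)) (bar_shuffle (a # as) bs))"

definition bar_product ::
    "('a list \<Rightarrow>\<^sub>0 int) \<Rightarrow> ('a list \<Rightarrow>\<^sub>0 int) \<Rightarrow> ('a list \<Rightarrow>\<^sub>0 int)" where
  "bar_product z w = frag_extend (\<lambda>as. frag_extend (\<lambda>bs. bar_shuffle as bs) w) z"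

definition pontryagin_product ::
    "('a, 'b) monoid_scheme \<Rightarrow> nat \<Rightarrow> nat \<Rightarrow>
      ('a list \<Rightarrow>\<^sub>0 int) set \<Rightarrow> ('a list \<Rightarrow>\<^sub>0 int) set \<Rightarrow> ('a list \<Rightarrow>\<^sub>0 int) set" where
  "pontryagin_product A p q c d =
    the_elem ((\<lambda>(z, w). homology_class A (p + q) (bar_product z w)) ` (c \<times> d))"

text \<open>
  The image of \<open>a\<^sub>1 \<and> \<dots> \<and> a\<^sub>n\<close> under the canonical map from the \<open>n\<close>-th exterior power of \<open>A\<close> to
  \<open>H\<^sub>n(A, \<int>)\<close>, that is, the Pontryagin product of the classes \<open>[a\<^sub>k]\<close> in \<open>H\<^sub>1(A, \<int>) = A\<close>.
\<close>

fun wedge_class :: "('a, 'b) monoid_scheme \<Rightarrow> 'a list \<Rightarrow> ('a list \<Rightarrow>\<^sub>0 int) set" where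
  "wedge_class A [] = homology_class A 0 (frag_of [])"
| "wedge_class A (a # as) =
     pontryagin_product A 1 (length as) (homology_class A 1 (frag_of [a])) (wedge_class A as)"


section \<open>The groups\<close>

definition GL2 :: "('a::comm_ring_1 ^ 2 ^ 2) monoid" where
  "GL2 = \<lparr>carrier = {M. invertible M}, monoid.mult = (**), one = mat 1\<rparr>"

definition SL2 :: "('a::comm_ring_1 ^ 2 ^ 2) monoid" where
  "SL2 = \<lparr>carrier = {M. det M = 1}, monoid.mult = (**), one = mat 1\<rparr>"

definition elementary_matrix :: "2 \<Rightarrow> 2 \<Rightarrow> 'a::comm_ring_1 \<Rightarrow> 'a ^ 2 ^ 2" where
  "elementary_matrix r s a = (\<chi> i j. if i = j then 1 else if i = r \<and> j = s then a else 0)"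

definition E2 :: "('a::comm_ring_1 ^ 2 ^ 2) monoid" where
  "E2 = GL2\<lparr>carrier := generate GL2 {elementary_matrix r s a |r s a. r \<noteq> s}\<rparr>"

definition tZt :: "int poly monoid" where
  "tZt = \<lparr>carrier = {f. coeff f 0 = 0}, monoid.mult = (+), one = 0\<rparr>"

definition upper_unipotent :: "int poly \<Rightarrow> int poly ^ 2 ^ 2" where
  "upper_unipotent f = elementary_matrix 1 2 f"

definition finitely_generated :: "('a, 'b) monoid_scheme \<Rightarrow> bool" where
  "finitely_generated G \<longleftrightarrow> (\<exists>S. finite S \<and> S \<subseteq> carrier G \<and> generate G S = carrier G)"


section \<open>The classes attached to exponent tuples\<close>

definition exponent_tuples :: "nat \<Rightarrow> nat list set" where
  "exponent_tuples i = {ls. length ls = i \<and> sorted_wrt (<) ls \<and> (\<forall>l\<in>set ls. 1 \<le> l)}"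

definition E2_class :: "nat list \<Rightarrow> ((int poly ^ 2 ^ 2) list \<Rightarrow>\<^sub>0 int) set" where
  "E2_class ls =
    homology_induced E2 (length ls) upper_unipotent (wedge_class tZt (map (\<lambda>l. monom 1 l) ls))"

text \<open>The inclusion of \<open>E2\<close> into \<open>SL2\<close> is the identity on matrices.\<close>

definition SL2_class :: "nat list \<Rightarrow> ((int poly ^ 2 ^ 2) list \<Rightarrow>\<^sub>0 int) set" where
  "SL2_class ls = homology_induced SL2 (length ls) (\<lambda>M. M) (E2_class ls)"

end

theory Submission
  imports Defs
begin

text \<open>
  \<open>SL\<^sub>2(\<int>[t])\<close> acts on the tree of the amalgam \<open>SL\<^sub>2(\<rat>[t]) = SL\<^sub>2(\<rat>) *\<^bsub>B(\<rat>)\<^esub> B(\<rat>[t])\<close>. The vertex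
  fixed by \<open>B(\<rat>[t])\<close> has stabiliser \<open>B(\<int>[t])\<close>, and the edges at this vertex have stabilisers
  \<open>{\<plusminus> u(c) | c \<in> \<int>}\<close>, because the only units of \<open>\<int>[t]\<close> are \<open>\<plusminus>1\<close>. Hence the projection
  \<open>\<plusminus> u(f) \<mapsto> f - f(0)\<close> extends to a homomorphism on \<open>SL\<^sub>2(\<int>[t])\<close>: add up, along the path from the base
  edge to its translate, the turns taken at the vertices in the orbit of that vertex. The path is
  computed by Euclid's algorithm over \<open>\<rat>[t]\<close>, so that no tree has to be mentioned: the homomorphism
  is a weighted sum of the Euclidean quotients.

  Its coefficients are characters \<open>\<phi>\<^sub>l\<close> of \<open>SL\<^sub>2(\<int>[t])\<close> with \<open>\<phi>\<^sub>l(u(t\<^sup>m)) = \<delta>\<^sub>l\<^sub>m\<close>. The cup product of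
  \<open>\<phi>\<^bsub>l\<^sub>1\<^esub>, \<dots>, \<phi>\<^bsub>l\<^sub>i\<^esub>\<close> pairs to 1 with the class of \<open>(l\<^sub>1, \<dots>, l\<^sub>i)\<close> and to 0 with that of any other tuple.
  As almost all \<open>\<phi>\<^sub>l\<close> vanish at a given matrix, such a cup product with large indices vanishes on any
  given finite set of homology classes but not identically.
\<close>

section \<open>Euclid's algorithm and the characters of \<open>SL\<^sub>2(\<int>[t])\<close>\<close>

lemma euclidean_size_uminus_poly: "euclidean_size (- p) = euclidean_size (p :: 'a::field poly)"
  by (simp add: euclidean_size_poly_def)

text \<open>
  The matrix with columns \<open>(x, y)\<close> and \<open>(z, w)\<close> is written as a product of unipotent matrices,
  rotations and a diagonal matrix by Euclid's algorithm on the bottom row; each quotient contributes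
  its \<open>l\<close>-th coefficient, weighted by \<open>W\<close> at the first column reached at that stage.
\<close>

function euclid_sum ::
    "('a::field poly \<Rightarrow> 'a poly \<Rightarrow> 'a) \<Rightarrow> nat \<Rightarrow> 'a poly \<Rightarrow> 'a poly \<Rightarrow> 'a poly \<Rightarrow> 'a poly \<Rightarrow> 'a" where
  "euclid_sum W l x y z w =
    (if y = 0 then W 1 0 * coeff (x * z) l
     else euclid_sum W l (w div y * x - z) (- (w mod y)) x y + W x y * coeff (w div y) l)"
  by pat_completeness auto
termination
proof (relation "measure (\<lambda>(W, l, x, y, z, w). euclidean_size y)")
  fix W l and x y z w :: "'a poly"
  assume "y \<noteq> 0"
  then have "euclidean_size (w mod y) < euclidean_size y"
    by (rule mod_size_less)
  then show "((W, l, w div y * x - z, - (w mod y), x, y), W, l, x, y, z, w)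
      \<in> measure (\<lambda>(W, l, x, y, z, w). euclidean_size y)"
    by (simp add: euclidean_size_uminus_poly)
qed auto

declare euclid_sum.simps [simp del]

lemma euclid_sum_base: "euclid_sum W l x 0 z w = W 1 0 * coeff (x * z) l"
  by (simp add: euclid_sum.simps)

lemma euclid_sum_step:
  "y \<noteq> 0 \<Longrightarrow> euclid_sum W l x y z w =
    euclid_sum W l (w div y * x - z) (- (w mod y)) x y + W x y * coeff (w div y) l"
  by (simp add: euclid_sum.simps)

lemma det_euclid_step:
  fixes x y z w :: "'a::field poly"
  assumes "x * w - z * y = 1"
  shows "(w div y * x - z) * y - x * (- (w mod y)) = 1"
proof -
  have "(q * x - z) * y - x * (- r) = x * (q * y + r) - z * y" for q r
    by (simp add: algebra_simps)
  then show ?thesis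
    using assms by simp
qed

text \<open>Each Euclidean step lowers the size of the bottom left entry \<open>y\<close> and keeps
  the determinant 1. Once \<open>y\<close> vanishes, \<open>x * w = 1\<close> forces
  \<open>x\<close> to be a nonzero constant.\<close>

lemma euclid_induct [consumes 1, case_names base step]:
  fixes x y z w :: "'a::field poly"
  assumes "x * w - z * y = 1"
    and base: "\<And>c z. c \<noteq> 0 \<Longrightarrow> P [:c:] 0 z [:inverse c:]"
    and step: "\<And>x y z w. x * w - z * y = 1 \<Longrightarrow> y \<noteq> 0 \<Longrightarrow>
      P (w div y * x - z) (- (w mod y)) x y \<Longrightarrow> P x y z w"
  shows "P x y z w"
  using assms(1)
proof (induction "euclidean_size y" arbitrary: x y z w rule: less_induct)
  case less
  show ?case
  proof (cases "y = 0")
    case True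
    then have xw: "x * w = 1"
      using less.prems by simp
    then have "x dvd 1"
      using dvdI[of 1 x w] by simp
    then obtain c where c: "x = [:c:]" "c \<noteq> 0"
      by (auto simp: is_unit_poly_iff dvd_field_iff)
    then have "w = [:inverse c:] * (x * w)"
      by (simp add: mult.assoc)
    then have "w = [:inverse c:]"
      using xw by simp
    then show ?thesis
      using base c True by simp
  next
    case False
    have "euclidean_size (- (w mod y)) < euclidean_size y"
      using mod_size_less[OF False, of w] by (simp add: euclidean_size_uminus_poly)
    then show ?thesis
      using less.hyps det_euclid_step[OF less.prems] step[OF less.prems False] by blast
  qed
qed

lemma euclid_sum_eventually_zero: "\<exists>N. \<forall>l\<ge>N. euclid_sum W l x y z w = 0"
\<comment> \<open>The bound must be chosen before the index, so the index argument of the induction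
  rule is filled with a dummy.\<close>
proof (induction W l\<equiv>"0::nat" x y z w rule: euclid_sum.induct)
  case (1 W x y z w)
  show ?case
  proof (cases "y = 0")
    case True
    have "\<forall>l\<ge>Suc (degree (x * z)). euclid_sum W l x y z w = 0"
      using True by (auto simp: euclid_sum_base coeff_eq_0)
    then show ?thesis ..
  next
    case False
    obtain N where "\<forall>l\<ge>N. euclid_sum W l (w div y * x - z) (- (w mod y)) x y = 0"
      using 1 False by blast
    then have "\<forall>l\<ge>max N (Suc (degree (w div y))). euclid_sum W l x y z w = 0"
      using False by (auto simp: euclid_sum_step coeff_eq_0)
    then show ?thesis ..
  qed
qed

section \<open>Behaviour of the Euclidean sum under matrix multiplication\<close>

locale euclid_weight =
  fixes W :: "'a::field poly \<Rightarrow> 'a poly \<Rightarrow> 'a" and l :: nat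
  assumes weight_smult: "c \<noteq> 0 \<Longrightarrow> W (smult c x) (smult c y) = c\<^sup>2 * W x y"
    and l_pos: "l > 0"
begin

abbreviation S where "S \<equiv> euclid_sum W l"

lemma coeff_const [simp]: "coeff [:c:] l = 0"
  using l_pos by (simp add: coeff_eq_0)

lemma weight_const: "c \<noteq> 0 \<Longrightarrow> W [:c:] 0 = c\<^sup>2 * W 1 0"
  using weight_smult[of c 1 0] by (simp add: one_pCons)

text \<open>A column operation by \<open>h\<close> adds \<open>h\<close> to the first quotient and
  alters nothing after it: the remainder and the next column stay the same. In the base case
  \<open>x * z\<close> grows by \<open>h * x\<^sup>2\<close>, and homogeneity of \<open>W\<close>
  turns the square of the constant \<open>x\<close> into the weight of
  \<open>(x, 0)\<close>.\<close>

lemma S_unipotent: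
  assumes "x * w - z * y = 1"
  shows "S x y (z + h * x) (w + h * y) = S x y z w + W x y * coeff h l"
  using assms
proof (induction rule: euclid_induct)
  case (base c z)
  then show ?case
    by (simp add: euclid_sum_base weight_const algebra_simps power2_eq_square)
next
  case (step x y z w)
  then show ?case
    by (simp add: euclid_sum_step algebra_simps)
qed

text \<open>The first quotient is divided by \<open>c\<^sup>2\<close>, and the weight, homogeneous
  of degree two, is multiplied by it. The next matrix is rescaled by \<open>inverse c\<close>, so
  \<open>c\<close> has to vary in the induction.\<close>

lemma S_diagonal:
  assumes "x * w - z * y = 1" "c \<noteq> 0"
  shows "S (smult c x) (smult c y) (smult (inverse c) z) (smult (inverse c) w) = S x y z w"
  using assms
proof (induction arbitrary: c rule: euclid_induct)
  case (base d z)
  then show ?case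
    by (simp add: euclid_sum_base)
next
  case (step x y z w)
  have "S (smult (inverse c) (w div y * x - z)) (smult (inverse c) (- (w mod y)))
      (smult (inverse (inverse c)) x) (smult (inverse (inverse c)) y)
     = S (w div y * x - z) (- (w mod y)) x y"
    using step.prems by (intro step.IH) simp
  moreover have 1: "c * (inverse c * inverse c) = inverse c"
    and 2: "c * (c * (inverse c * (inverse c * t))) = t" for t
    using step.prems by (simp_all add: field_simps)
  ultimately show ?case
    using step.hyps step.prems
    by (simp add: euclid_sum_step weight_smult div_smult_left div_smult_right
        mod_smult_left mod_smult_right smult_diff_right power2_eq_square 1 2 mult_ac)
qed

lemma S_uminus:
  assumes "x * w - z * y = 1"
  shows "S (- x) (- y) (- z) (- w) = S x y z w"
  using S_diagonal[OF assms, of "-1"] by simp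

text \<open>When the quotient is zero, the Euclidean step is exactly the rotation and adds
  nothing.\<close>

lemma S_rotate_less:
  assumes "x * w - z * y = 1" "y \<noteq> 0" "w div y = 0"
  shows "S x y z w = S (- z) (- w) x y"
proof -
  have "w mod y = w"
    using div_mult_mod_eq[of w y] assms(3) by simp
  then show ?thesis
    using assms by (simp add: euclid_sum_step)
qed

lemma S_rotate:
  assumes det: "x * w - z * y = 1"
  shows "S (- z) (- w) x y = S x y z w"
proof -
  \<comment> \<open>The entries of the bottom row cannot both vanish, as the determinant is 1. If
    their degrees differ, one of the two matrices has first quotient zero and its Euclidean step is
    the rotation; rotating twice only changes all signs.\<close>
  consider "y \<noteq> 0" "w div y = 0" | "w \<noteq> 0" "y div (- w) = 0" | "y \<noteq> 0" "w \<noteq> 0" "degree y = degree w"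
  proof -
    have "y \<noteq> 0 \<or> w \<noteq> 0"
      using det by auto
    then show ?thesis
      using that by (cases "degree y" "degree w" rule: linorder_cases) (auto simp: div_poly_eq_0_iff)
  qed
  then show ?thesis
  proof cases
    case 1
    then show ?thesis
      using S_rotate_less[OF det] by simp
  next
    case 2
    have "- z * y - x * (- w) = 1"
      using det by (simp add: algebra_simps)
    then have "S (- z) (- w) x y = S (- x) (- y) (- z) (- w)"
      using 2 by (intro S_rotate_less) auto
    then show ?thesis
      using S_uminus[OF det] by simp
  next
    case 3
    \<comment> \<open>For equal degrees the first quotients of the two sides are the nonzero
      constants \<open>c\<close> and \<open>- inverse c\<close>, whose \<open>l\<close>-th
      coefficients vanish because \<open>l > 0\<close>. After they are removed and both sides are
      rotated, the two matrices differ only by a constant unipotent and a diagonal factor.\<close>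
    define c where "c = lead_coeff w / lead_coeff y"
    have c: "c \<noteq> 0"
      using 3(1,2) by (simp add: c_def)
    define r where "r = w - smult c y"
    define s where "s = z - smult c x"
    have r: "r = 0 \<or> degree r < degree y"
    proof (cases "r = 0")
      case False
      have "degree r \<le> degree y"
        unfolding r_def using 3 by (intro degree_diff_le) auto
      moreover have "coeff r (degree y) = lead_coeff w - c * lead_coeff y"
        using 3(3) by (simp add: r_def)
      then have "coeff r (degree y) = 0"
        using 3(1) by (simp add: c_def)
      ultimately show ?thesis
        using False by (metis leading_coeff_0_iff le_neq_implies_less)
    qed simp
    have w: "w = r + [:c:] * y" and z: "z = s + [:c:] * x"
      by (simp_all add: r_def s_def)
    have det': "x * r - s * y = 1"
      using det by (simp add: w z algebra_simps)
    have "S x y z w = S x y s r"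
      unfolding z w by (subst S_unipotent[OF det']) simp
    also have "\<dots> = S (- s) (- r) x y"
      using r 3 det' by (intro S_rotate_less) (auto simp: div_poly_eq_0_iff)
    finally have 1: "S x y z w = S (- s) (- r) x y" .
    have det2: "- z * smult (- inverse c) r - (smult (- inverse c) s) * (- w) = 1"
    proof -
      have "- z * smult (- inverse c) r - (smult (- inverse c) s) * (- w)
          = smult (inverse c) (z * r - s * w)"
        by (simp add: smult_diff_right)
      also have "z * r - s * w = smult c (x * r - s * y)"
        by (simp add: z w algebra_simps smult_diff_right)
      finally show ?thesis
        using c det' by simp
    qed
    have "S (- z) (- w) x y
        = S (- z) (- w) (smult (- inverse c) s + [:- inverse c:] * (- z))
            (smult (- inverse c) r + [:- inverse c:] * (- w))"
      using c by (simp add: z w smult_add_right smult_diff_right)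
    also have "\<dots> = S (- z) (- w) (smult (- inverse c) s) (smult (- inverse c) r)"
      by (subst S_unipotent[OF det2]) simp
    also have "\<dots> = S (- smult (- inverse c) s) (- smult (- inverse c) r) (- z) (- w)"
      using r 3 det2 c by (intro S_rotate_less)
       (auto simp: div_poly_eq_0_iff)
    also have "\<dots> = S (smult (- inverse c) (- s)) (smult (- inverse c) (- r))
        (smult (inverse (- inverse c)) x + [:- c:] * smult (- inverse c) (- s))
        (smult (inverse (- inverse c)) y + [:- c:] * smult (- inverse c) (- r))"
      using c by (simp add: z w minus_diff_commute)
    also have "\<dots> = S (smult (- inverse c) (- s)) (smult (- inverse c) (- r))
        (smult (inverse (- inverse c)) x) (smult (inverse (- inverse c)) y)"
    proof (subst S_unipotent)
      show "smult (- inverse c) (- s) * smult (inverse (- inverse c)) y -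
          smult (inverse (- inverse c)) x * smult (- inverse c) (- r) = 1"
        using c det' by (simp add: algebra_simps)
    qed simp
    also have "\<dots> = S (- s) (- r) x y"
      using c det' by (intro S_diagonal) (simp_all add: algebra_simps)
    finally show ?thesis
      using 1 by simp
  qed
qed

text \<open>Induction along Euclid's algorithm for the right factor. It uses column operations only,
  and these commute with multiplication from the left; invariance of \<open>W\<close> under the left
  factor keeps the contribution of every quotient. The arguments of \<open>S\<close> list a matrix
  column by column.\<close>

theorem S_mult:
  assumes "a * d - b * c = 1"
    and invariant: "\<And>x y. W (a * x + b * y) (c * x + d * y) = W x y"
    and "x * w - z * y = 1"
  shows "S (a * x + b * y) (c * x + d * y) (a * z + b * w) (c * z + d * w) = S a c b d + S x y z w"
  using assms(3)
proof (induction rule: euclid_induct)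
  case (base e z)
  have det: "smult e a * smult (inverse e) d - smult (inverse e) b * smult e c = 1"
    using assms(1) base by simp
  have "S (a * [:e:] + b * 0) (c * [:e:] + d * 0) (a * z + b * [:inverse e:]) (c * z + d * [:inverse e:])
      = S (smult e a) (smult e c) (smult (inverse e) b + smult (inverse e) z * smult e a)
          (smult (inverse e) d + smult (inverse e) z * smult e c)"
    using base by (simp add: algebra_simps)
  also have "\<dots> = S a c b d + W (smult e a) (smult e c) * coeff (smult (inverse e) z) l"
    using assms(1) base by (subst S_unipotent[OF det]) (simp add: S_diagonal)
  \<comment> \<open>Invariance at \<open>(1, 0)\<close>: the first column \<open>(a, c)\<close> of
    the left factor has the same weight as that of the identity.\<close>
  also have "W (smult e a) (smult e c) = e\<^sup>2 * W 1 0"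
    using base invariant[of 1 0] by (simp add: weight_smult)
  finally show ?case
    using base by (simp add: euclid_sum_base power2_eq_square)
next
  case (step x y z w)
  define f where "f = w div y"
  define r where "r = w mod y"
  have w: "w = f * y + r"
    by (simp add: f_def r_def)
  define s where "s = z - f * x"
  have s: "f * x - z = - s" and z: "z = s + f * x"
    by (simp_all add: s_def)
  have det1: "(a * x + b * y) * (c * s + d * r) - (a * s + b * r) * (c * x + d * y) = 1"
  proof -
    have "(a * x + b * y) * (c * s + d * r) - (a * s + b * r) * (c * x + d * y)
      = (a * d - b * c) * (x * w - z * y)"
      by (simp add: w z algebra_simps)
    then show ?thesis
      using assms(1) step.hyps by simp
  qed
  have "S (a * x + b * y) (c * x + d * y) (a * z + b * w) (c * z + d * w)
      = S (a * x + b * y) (c * x + d * y) ((a * s + b * r) + f * (a * x + b * y))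
         ((c * s + d * r) + f * (c * x + d * y))"
    by (simp add: w z algebra_simps)
  also have "\<dots> = S (a * x + b * y) (c * x + d * y) (a * s + b * r) (c * s + d * r)
      + W x y * coeff f l"
    by (subst S_unipotent[OF det1]) (simp add: invariant)
  also have "S (a * x + b * y) (c * x + d * y) (a * s + b * r) (c * s + d * r)
     = S (- (a * s + b * r)) (- (c * s + d * r)) (a * x + b * y) (c * x + d * y)"
    using S_rotate[OF det1] by simp
  also have "\<dots> = S (a * (- s) + b * (- r)) (c * (- s) + d * (- r)) (a * x + b * y) (c * x + d * y)"
    by (simp add: algebra_simps)
  also have "\<dots> = S a c b d + S (- s) (- r) x y"
    using step.IH unfolding f_def[symmetric] r_def[symmetric] s .
  finally show ?case
    using step.hyps by (simp add: euclid_sum_step f_def r_def s_def)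
qed

end

section \<open>Unimodular pairs and their weight\<close>

abbreviation to_rat_poly :: "int poly \<Rightarrow> rat poly" where
  "to_rat_poly \<equiv> map_poly of_int"

lemma to_rat_poly_add: "to_rat_poly (p + q) = to_rat_poly p + to_rat_poly q"
  by (simp add: poly_eq_iff coeff_map_poly)

lemma to_rat_poly_diff: "to_rat_poly (p - q) = to_rat_poly p - to_rat_poly q"
  by (simp add: poly_eq_iff coeff_map_poly)

lemma to_rat_poly_mult: "to_rat_poly (p * q) = to_rat_poly p * to_rat_poly q"
  by (simp add: poly_eq_iff coeff_map_poly coeff_mult)

text \<open>These are the pairs that occur as first column of a matrix of determinant 1: a Bezout
  relation supplies the second column.\<close>

definition unimodular :: "'a::comm_ring_1 \<Rightarrow> 'a \<Rightarrow> bool" where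
  "unimodular a b \<longleftrightarrow> (\<exists>r s. r * a + s * b = 1)"

text \<open>The new Bezout coefficients are the row \<open>(r, s)\<close> times the adjugate
  matrix.\<close>

lemma unimodular_transform:
  assumes "unimodular e f" "a * d - b * c = 1"
  shows "unimodular (a * e + b * f) (c * e + d * f)"
proof -
  obtain r s where "r * e + s * f = 1"
    using assms(1) by (auto simp: unimodular_def)
  moreover have "(r * d - s * c) * (a * e + b * f) + (s * a - r * b) * (c * e + d * f)
      = (a * d - b * c) * (r * e + s * f)"
    by (simp add: algebra_simps)
  ultimately show ?thesis
    using assms(2) unfolding unimodular_def by auto
qed

definition unimodular_scale :: "rat poly \<Rightarrow> rat poly \<Rightarrow> rat \<Rightarrow> bool" where
  "unimodular_scale x y p \<longleftrightarrow>
    (\<exists>a b. unimodular a b \<and> x = smult p (to_rat_poly a) \<and> y = smult p (to_rat_poly b))"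

text \<open>
  The scale \<open>p\<close> is unique up to sign if it exists. The weight is the indicator function of the
  \<open>SL\<^sub>2(\<int>[t])\<close>-orbit of the end \<open>(1, 0)\<close> of the tree, twisted by the square of the scale so that it
  becomes homogeneous.
\<close>

definition unimodular_weight :: "rat poly \<Rightarrow> rat poly \<Rightarrow> rat" where
  "unimodular_weight x y =
    (if \<exists>p. unimodular_scale x y p then (SOME p. unimodular_scale x y p)\<^sup>2 else 0)"

text \<open>The Bezout combination that gives 1 on the first integral pair gives an integral
  polynomial on the second. Applied to the common vector it yields \<open>p\<close> on one side and
  \<open>q\<close> times that polynomial on the other, and constant coefficients are
  compared.\<close>

lemma unimodular_scale_dvd:
  assumes "unimodular_scale x y p" "unimodular_scale x y q"
  shows "\<exists>m::int. p = q * of_int m"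
proof -
  obtain a b r s where ab: "x = smult p (to_rat_poly a)" "y = smult p (to_rat_poly b)"
    and rs: "r * a + s * b = 1"
    using assms(1) by (auto simp: unimodular_scale_def unimodular_def)
  obtain a' b' where ab': "x = smult q (to_rat_poly a')" "y = smult q (to_rat_poly b')"
    using assms(2) by (auto simp: unimodular_scale_def)
  have "smult p (to_rat_poly (r * a + s * b)) = to_rat_poly r * x + to_rat_poly s * y"
    by (simp add: ab to_rat_poly_add to_rat_poly_mult smult_add_right)
  also have "\<dots> = smult q (to_rat_poly (r * a' + s * b'))"
    by (simp add: ab' to_rat_poly_add to_rat_poly_mult smult_add_right)
  finally have "coeff (smult p (to_rat_poly (r * a + s * b))) 0
      = coeff (smult q (to_rat_poly (r * a' + s * b'))) 0"
    by simp
  then have "p = q * of_int (coeff (r * a' + s * b') 0)"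
    unfolding rs by (simp add: coeff_map_poly)
  then show ?thesis ..
qed

text \<open>Each scale is an integer multiple of the other, so nonzero scales differ by a unit of
  the integers.\<close>

lemma unimodular_scale_unique:
  assumes "unimodular_scale x y p" "unimodular_scale x y q"
  shows "p\<^sup>2 = q\<^sup>2"
proof (cases "q = 0")
  case True
  then show ?thesis
    using unimodular_scale_dvd[OF assms] by auto
next
  case False
  obtain m n :: int where m: "p = q * of_int m" and "q = p * of_int n"
    using unimodular_scale_dvd assms by metis
  then have "q * of_int (m * n) = q * 1"
    by (metis mult.assoc mult.right_neutral of_int_mult)
  then have "(of_int (m * n) :: rat) = of_int 1"
    using False by (simp only: mult_cancel_left of_int_1) simp
  then have "m * n = 1"
    by (simp only: of_int_eq_iff)
  then have "\<bar>m\<bar> = 1"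
    by (metis zmult_eq_1_iff abs_1 abs_minus_cancel)
  then show ?thesis
    by (auto simp: m abs_if split: if_splits)
qed

lemma unimodular_weight_eq:
  assumes "unimodular_scale x y p"
  shows "unimodular_weight x y = p\<^sup>2"
  using assms unimodular_scale_unique[OF someI[of "unimodular_scale x y"], OF assms assms]
  by (auto simp: unimodular_weight_def)

lemma unimodular_weight_1_0: "unimodular_weight 1 0 = 1"
proof -
  have "unimodular_scale 1 0 1"
    unfolding unimodular_scale_def unimodular_def
    by (intro exI[of _ 1] exI[of _ 0] conjI) auto
  then show ?thesis
    by (simp add: unimodular_weight_eq)
qed

lemma unimodular_scale_smult:
  "unimodular_scale x y p \<Longrightarrow> unimodular_scale (smult c x) (smult c y) (c * p)"
  unfolding unimodular_scale_def by (metis smult_smult)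

lemma unimodular_weight_smult:
  assumes "c \<noteq> 0"
  shows "unimodular_weight (smult c x) (smult c y) = c\<^sup>2 * unimodular_weight x y"
proof (cases "\<exists>p. unimodular_scale x y p")
  case True
  then show ?thesis
    using unimodular_scale_smult unimodular_weight_eq by (metis power_mult_distrib)
next
  case False
  moreover have "\<not> unimodular_scale (smult c x) (smult c y) p" for p
    using False assms unimodular_scale_smult[of "smult c x" "smult c y" p "inverse c"] by auto
  ultimately show ?thesis
    by (simp add: unimodular_weight_def)
qed

lemma unimodular_scale_transform:
  assumes "unimodular_scale x y p" "a * d - b * c = 1"
  shows "unimodular_scale (to_rat_poly a * x + to_rat_poly b * y) (to_rat_poly c * x + to_rat_poly d * y) p"
proof -
  obtain e f where ef: "unimodular e f" "x = smult p (to_rat_poly e)" "y = smult p (to_rat_poly f)"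
    using assms(1) by (auto simp: unimodular_scale_def)
  show ?thesis
    unfolding unimodular_scale_def
    by (rule exI[of _ "a * e + b * f"], rule exI[of _ "c * e + d * f"])
      (use unimodular_transform[OF ef(1) assms(2)] in
        \<open>simp add: ef(2,3) to_rat_poly_add to_rat_poly_mult smult_add_right\<close>)
qed

lemma unimodular_weight_transform:
  assumes det: "a * d - b * c = 1"
  shows "unimodular_weight (to_rat_poly a * x + to_rat_poly b * y) (to_rat_poly c * x + to_rat_poly d * y)
    = unimodular_weight x y" (is "unimodular_weight ?x ?y = _")
proof -
  \<comment> \<open>The adjugate has determinant 1 as well and undoes the transformation, which
    gives the converse implication between the scales.\<close>
  have det': "d * a - (- b) * (- c) = 1"
    using det by (simp add: algebra_simps)
  have "to_rat_poly (a * d - b * c) = 1"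
    using det by simp
  then have 1: "to_rat_poly a * to_rat_poly d - to_rat_poly b * to_rat_poly c = 1"
    by (simp add: to_rat_poly_diff to_rat_poly_mult)
  have "to_rat_poly d * ?x + to_rat_poly (- b) * ?y
      = (to_rat_poly a * to_rat_poly d - to_rat_poly b * to_rat_poly c) * x"
    using to_rat_poly_diff[of 0 b] by (simp add: algebra_simps)
  moreover have "to_rat_poly (- c) * ?x + to_rat_poly a * ?y
      = (to_rat_poly a * to_rat_poly d - to_rat_poly b * to_rat_poly c) * y"
    using to_rat_poly_diff[of 0 c] by (simp add: algebra_simps)
  ultimately have "unimodular_scale ?x ?y = unimodular_scale x y"
    using unimodular_scale_transform[OF _ det, of x y]
      unimodular_scale_transform[OF _ det', of ?x ?y] by (auto simp: 1 fun_eq_iff)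
  then show ?thesis
    by (simp add: unimodular_weight_def)
qed

section \<open>The characters and their values on unipotent matrices\<close>

definition SL2_character :: "nat \<Rightarrow> int poly ^ 2 ^ 2 \<Rightarrow> rat" where
  "SL2_character l M = euclid_sum unimodular_weight l
    (to_rat_poly (M $ 1 $ 1)) (to_rat_poly (M $ 2 $ 1)) (to_rat_poly (M $ 1 $ 2)) (to_rat_poly (M $ 2 $ 2))"

lemma SL2_character_mult:
  assumes "l > 0" "M \<in> carrier SL2" "N \<in> carrier SL2"
  shows "SL2_character l (M \<otimes>\<^bsub>SL2\<^esub> N) = SL2_character l M + SL2_character l N"
proof -
  interpret euclid_weight unimodular_weight l
    by unfold_locales (simp_all add: assms unimodular_weight_smult)
  have det: "A $ 1 $ 1 * A $ 2 $ 2 - A $ 1 $ 2 * A $ 2 $ 1 = 1" if "A \<in> carrier SL2" for A :: "int poly ^ 2 ^ 2"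
    using that by (simp add: SL2_def det_2)
  have det_rat: "to_rat_poly (A $ 1 $ 1) * to_rat_poly (A $ 2 $ 2) -
      to_rat_poly (A $ 1 $ 2) * to_rat_poly (A $ 2 $ 1) = 1" if "A \<in> carrier SL2" for A
    using arg_cong[OF det[OF that], of to_rat_poly] by (simp add: to_rat_poly_diff to_rat_poly_mult)
  show ?thesis
    using S_mult[OF det_rat[OF assms(2)] unimodular_weight_transform[OF det[OF assms(2)]] det_rat[OF assms(3)]]
    by (simp add: SL2_character_def SL2_def matrix_matrix_mult_def sum_2 to_rat_poly_add to_rat_poly_mult)
qed

text \<open>The bottom left entry is zero, so Euclid's algorithm stops at once, and the weight of
  \<open>(1, 0)\<close> is normalised to 1.\<close>

lemma SL2_character_upper_unipotent:
  "SL2_character l (upper_unipotent f) = of_int (coeff f l)"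
  by (simp add: SL2_character_def upper_unipotent_def elementary_matrix_def euclid_sum_base
      unimodular_weight_1_0 coeff_map_poly)

lemma SL2_character_eventually_zero: "\<exists>N. \<forall>l\<ge>N. SL2_character l M = 0"
  unfolding SL2_character_def by (rule euclid_sum_eventually_zero)

section \<open>The bar complex\<close>

lemmas frag_extend_linear =
  frag_extend_add frag_extend_minus frag_extend_diff frag_extend_cmul

lemma frag_induct [case_names zero one diff]:
  assumes "P 0" "\<And>x. P (frag_of x)" "\<And>a b. P a \<Longrightarrow> P b \<Longrightarrow> P (a - b)"
  shows "P c"
  by (rule frag_induction[OF subset_UNIV]) (use assms in auto)

lemma frag_cmul_diff_distrib2: "frag_cmul k (a - b) = frag_cmul k a - frag_cmul k b"
  by (rule poly_mapping_eqI) (simp add: lookup_minus algebra_simps)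

lemma frag_extend_fun_diff:
  "frag_extend (\<lambda>x. f x - g x) c = frag_extend f c - frag_extend g c"
  by (induction c rule: frag_induct) (auto simp: frag_extend_diff)

lemma frag_extend_fun_add:
  "frag_extend (\<lambda>x. f x + g x) c = frag_extend f c + frag_extend g c"
  by (induction c rule: frag_induct) (auto simp: frag_extend_diff)

lemma frag_extend_fun_cmul:
  "frag_extend (\<lambda>x. frag_cmul k (f x)) c = frag_cmul k (frag_extend f c)"
  by (induction c rule: frag_induct)
    (auto simp: frag_extend_diff frag_cmul_diff_distrib2)

definition bar_cons :: "'a \<Rightarrow> ('a list \<Rightarrow>\<^sub>0 int) \<Rightarrow> ('a list \<Rightarrow>\<^sub>0 int)" where
  "bar_cons a = frag_extend (\<lambda>gs. frag_of (a # gs))"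

definition bar_tail :: "('a list \<Rightarrow>\<^sub>0 int) \<Rightarrow> ('a list \<Rightarrow>\<^sub>0 int)" where
  "bar_tail = frag_extend (\<lambda>gs. if gs = [] then 0 else frag_of (tl gs))"

text \<open>This is the first inner face of \<open>a # gs\<close>. The value on the empty word is
  the last face of \<open>[a]\<close>, so the final face needs no separate treatment.\<close>

fun mult_head :: "('a, 'b) monoid_scheme \<Rightarrow> 'a \<Rightarrow> 'a list \<Rightarrow> 'a list" where
  "mult_head G a [] = []"
| "mult_head G a (b # bs) = (a \<otimes>\<^bsub>G\<^esub> b) # bs"

definition bar_mult_head :: "('a, 'b) monoid_scheme \<Rightarrow> 'a \<Rightarrow> ('a list \<Rightarrow>\<^sub>0 int) \<Rightarrow> ('a list \<Rightarrow>\<^sub>0 int)" where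
  "bar_mult_head G a = frag_extend (\<lambda>gs. frag_of (mult_head G a gs))"

text \<open>The Koszul sign as an operator, so that the shuffle recursion can be stated for chains
  of mixed degree.\<close>

definition bar_sign :: "('a list \<Rightarrow>\<^sub>0 int) \<Rightarrow> ('a list \<Rightarrow>\<^sub>0 int)" where
  "bar_sign = frag_extend (\<lambda>gs. frag_cmul ((-1) ^ length gs) (frag_of gs))"

text \<open>The sum of all faces but the zeroth one. In contrast to the whole boundary it satisfies a
  recursion on the first letter that does not mention the second one.\<close>

fun inner_faces :: "('a, 'b) monoid_scheme \<Rightarrow> 'a list \<Rightarrow> ('a list \<Rightarrow>\<^sub>0 int)" where
  "inner_faces G [] = 0"
| "inner_faces G (a # gs) = - frag_of (mult_head G a gs) - bar_cons a (inner_faces G gs)"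

definition bar_inner :: "('a, 'b) monoid_scheme \<Rightarrow> ('a list \<Rightarrow>\<^sub>0 int) \<Rightarrow> ('a list \<Rightarrow>\<^sub>0 int)" where
  "bar_inner G = frag_extend (inner_faces G)"

lemma bar_cons_linear [simp]:
  "bar_cons a 0 = 0"
  "bar_cons a (x + y) = bar_cons a x + bar_cons a y"
  "bar_cons a (x - y) = bar_cons a x - bar_cons a y"
  "bar_cons a (- x) = - bar_cons a x"
  "bar_cons a (frag_cmul k x) = frag_cmul k (bar_cons a x)"
  by (simp_all add: bar_cons_def frag_extend_linear)

lemma bar_tail_linear [simp]:
  "bar_tail 0 = 0"
  "bar_tail (x + y) = bar_tail x + bar_tail y"
  "bar_tail (x - y) = bar_tail x - bar_tail y"
  "bar_tail (- x) = - bar_tail x"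
  "bar_tail (frag_cmul k x) = frag_cmul k (bar_tail x)"
  by (simp_all add: bar_tail_def frag_extend_linear)

lemma bar_mult_head_linear [simp]:
  "bar_mult_head G a 0 = 0"
  "bar_mult_head G a (x + y) = bar_mult_head G a x + bar_mult_head G a y"
  "bar_mult_head G a (x - y) = bar_mult_head G a x - bar_mult_head G a y"
  "bar_mult_head G a (- x) = - bar_mult_head G a x"
  "bar_mult_head G a (frag_cmul k x) = frag_cmul k (bar_mult_head G a x)"
  by (simp_all add: bar_mult_head_def frag_extend_linear)

lemma bar_sign_linear [simp]:
  "bar_sign 0 = 0"
  "bar_sign (x + y) = bar_sign x + bar_sign y"
  "bar_sign (x - y) = bar_sign x - bar_sign y"
  "bar_sign (- x) = - bar_sign x"
  "bar_sign (frag_cmul k x) = frag_cmul k (bar_sign x)"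
  by (simp_all add: bar_sign_def frag_extend_linear)

lemma bar_inner_linear [simp]:
  "bar_inner G 0 = 0"
  "bar_inner G (x + y) = bar_inner G x + bar_inner G y"
  "bar_inner G (x - y) = bar_inner G x - bar_inner G y"
  "bar_inner G (- x) = - bar_inner G x"
  "bar_inner G (frag_cmul k x) = frag_cmul k (bar_inner G x)"
  by (simp_all add: bar_inner_def frag_extend_linear)

lemma bar_boundary_linear [simp]:
  "bar_boundary G 0 = 0"
  "bar_boundary G (x + y) = bar_boundary G x + bar_boundary G y"
  "bar_boundary G (x - y) = bar_boundary G x - bar_boundary G y"
  "bar_boundary G (- x) = - bar_boundary G x"
  "bar_boundary G (frag_cmul k x) = frag_cmul k (bar_boundary G x)"
  by (simp_all add: bar_boundary_def frag_extend_linear)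

lemma bar_chain_map_linear [simp]:
  "bar_chain_map f 0 = 0"
  "bar_chain_map f (x + y) = bar_chain_map f x + bar_chain_map f y"
  "bar_chain_map f (x - y) = bar_chain_map f x - bar_chain_map f y"
  "bar_chain_map f (- x) = - bar_chain_map f x"
  by (simp_all add: bar_chain_map_def frag_extend_linear)

lemma bar_product_linear [simp]:
  "bar_product 0 w = 0"
  "bar_product z 0 = 0"
  "bar_product (z + z') w = bar_product z w + bar_product z' w"
  "bar_product (z - z') w = bar_product z w - bar_product z' w"
  "bar_product (- z) w = - bar_product z w"
  "bar_product (frag_cmul k z) w = frag_cmul k (bar_product z w)"
  "bar_product z (w + w') = bar_product z w + bar_product z w'"
  "bar_product z (w - w') = bar_product z w - bar_product z w'"
  "bar_product z (frag_cmul k w) = frag_cmul k (bar_product z w)"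
  by (simp_all add: bar_product_def frag_extend_linear frag_extend_fun_add frag_extend_fun_diff
      frag_extend_fun_cmul frag_extend_eq_0)

lemma bar_product_uminus_right [simp]: "bar_product z (- w) = - bar_product z w"
  using bar_product_linear(8)[of z 0 w] by simp

lemma bar_of [simp]:
  "bar_cons a (frag_of gs) = frag_of (a # gs)"
  "bar_mult_head G a (frag_of gs) = frag_of (mult_head G a gs)"
  "bar_sign (frag_of gs) = frag_cmul ((-1) ^ length gs) (frag_of gs)"
  "bar_inner G (frag_of gs) = inner_faces G gs"
  "bar_tail (frag_of gs) = (if gs = [] then 0 else frag_of (tl gs))"
  "bar_chain_map f (frag_of gs) = frag_of (map f gs)"
  "bar_product (frag_of as) (frag_of bs) = bar_shuffle as bs"
  by (simp_all add: bar_cons_def bar_mult_head_def bar_sign_def bar_inner_def bar_tail_def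
      bar_chain_map_def bar_product_def)

lemma bar_tail_cons [simp]: "bar_tail (bar_cons a x) = x"
  by (induction x rule: frag_induct) auto

lemma bar_mult_head_cons [simp]: "bar_mult_head G a (bar_cons b x) = bar_cons (a \<otimes>\<^bsub>G\<^esub> b) x"
  by (induction x rule: frag_induct) auto

lemma bar_inner_cons [simp]:
  "bar_inner G (bar_cons a x) = - bar_mult_head G a x - bar_cons a (bar_inner G x)"
  by (induction x rule: frag_induct) auto

lemma bar_sign_cons [simp]: "bar_sign (bar_cons a x) = - bar_cons a (bar_sign x)"
  by (induction x rule: frag_induct) (auto simp: algebra_simps)

lemma bar_chain_map_cons [simp]: "bar_chain_map f (bar_cons a x) = bar_cons (f a) (bar_chain_map f x)"
  by (induction x rule: frag_induct) auto

section \<open>The boundary as zeroth face plus inner faces\<close>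

lemma bar_face_Suc_Cons: "k > 0 \<Longrightarrow> bar_face G (Suc k) (a # gs) = a # bar_face G k gs"
  by (cases k) (auto simp: bar_face_def)

lemma bar_face_1: "bar_face G (Suc 0) (a # gs) = mult_head G a gs"
  by (cases gs) (auto simp: bar_face_def)

text \<open>Face 1 of \<open>a # gs\<close> absorbs \<open>a\<close> into \<open>gs\<close>; every
  later face leaves \<open>a\<close> in front of a face of \<open>gs\<close> with index one lower,
  which accounts for the change of sign.\<close>

lemma inner_faces_eq_sum:
  "inner_faces G gs = (\<Sum>k<length gs. frag_cmul ((-1) ^ Suc k) (frag_of (bar_face G (Suc k) gs)))"
proof (induction gs)
  case (Cons a gs)
  have cons_sum: "bar_cons a (\<Sum>k<n. h k) = (\<Sum>k<n. bar_cons a (h k))" for h and n :: nat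
    by (induction n) auto
  have "(\<Sum>k<length (a # gs). frag_cmul ((-1) ^ Suc k) (frag_of (bar_face G (Suc k) (a # gs))))
      = - frag_of (mult_head G a gs)
        + (\<Sum>k<length gs. frag_cmul ((-1) ^ Suc (Suc k)) (frag_of (bar_face G (Suc (Suc k)) (a # gs))))"
    by (simp only: length_Cons sum.lessThan_Suc_shift) (simp add: bar_face_1)
  also have "(\<Sum>k<length gs. frag_cmul ((-1) ^ Suc (Suc k)) (frag_of (bar_face G (Suc (Suc k)) (a # gs))))
      = - bar_cons a (inner_faces G gs)"
    by (simp add: Cons.IH cons_sum bar_face_Suc_Cons flip: sum_negf)
  finally show ?case
    by simp
qed simp

lemma bar_boundary_frag_of: "bar_boundary G (frag_of gs) = bar_tail (frag_of gs) + inner_faces G gs"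
proof (cases "gs = []")
  case False
  have "bar_boundary G (frag_of gs) = (\<Sum>k\<le>length gs. frag_cmul ((-1) ^ k) (frag_of (bar_face G k gs)))"
    using False by (simp add: bar_boundary_def)
  also have "\<dots> = frag_of (bar_face G 0 gs) + inner_faces G gs"
    by (simp only: inner_faces_eq_sum sum.atMost_shift) simp
  finally show ?thesis
    using False by (simp add: bar_face_def)
qed (simp add: bar_boundary_def)

lemma bar_boundary_eq: "bar_boundary G x = bar_tail x + bar_inner G x"
  by (induction x rule: frag_induct) (auto simp: bar_boundary_frag_of)

subsection \<open>The boundary squares to zero\<close>

lemma bar_tail_mult_head: "bar_tail (bar_mult_head G a x) = bar_tail x"
proof (induction x rule: frag_induct)
  case (one gs)
  then show ?case
    by (cases gs) auto
qed auto

lemma (in monoid) inner_faces_mult_head: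
  assumes "a \<in> carrier G" "set gs \<subseteq> carrier G"
  shows "inner_faces G (mult_head G a gs) = bar_mult_head G a (inner_faces G gs)"
proof (cases gs)
  case (Cons b bs)
  then have "mult_head G (a \<otimes> b) bs = mult_head G a (mult_head G b bs)"
    using assms by (cases bs) (auto simp: m_assoc)
  then show ?thesis
    by (simp add: Cons)
qed simp

text \<open>For \<open>a # gs\<close>, absorbing \<open>a\<close> before or after taking inner faces
  of \<open>gs\<close> gives the same chain with opposite signs. What remains is \<open>a\<close> in
  front of the same expression for \<open>gs\<close>.\<close>

lemma (in monoid) bar_inner_inner_faces:
  "set gs \<subseteq> carrier G \<Longrightarrow> bar_inner G (inner_faces G gs) = 0"
  by (induction gs) (auto simp: inner_faces_mult_head)

lemma (in monoid) bar_boundary_boundary_frag_of: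
  assumes "set gs \<subseteq> carrier G"
  shows "bar_boundary G (bar_boundary G (frag_of gs)) = 0"
proof (cases gs)
  case (Cons a bs)
  then have "bar_inner G (inner_faces G gs) = 0"
    using assms by (intro bar_inner_inner_faces) auto
  \<comment> \<open>Absorbing \<open>a\<close> changes only the first letter, which
    \<open>bar_tail\<close> drops. The tail of the inner faces thus cancels the boundary of the
    tail.\<close>
  moreover have "bar_tail (frag_of (mult_head G a bs)) = bar_tail (frag_of bs)"
    using bar_tail_mult_head[of G a "frag_of bs"] by simp
  ultimately show ?thesis
    using Cons by (simp add: bar_boundary_eq)
qed (simp add: bar_boundary_def)

subsection \<open>The boundary is a derivation of the shuffle product\<close>

lemma bar_product_Nil_left [simp]: "bar_product (frag_of []) w = w"
  by (induction w rule: frag_induct) auto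

lemma bar_shuffle_Nil_right [simp]: "bar_shuffle as [] = frag_of as"
  by (cases as) auto

lemma bar_product_Nil_right [simp]: "bar_product z (frag_of []) = z"
  by (induction z rule: frag_induct) auto

lemma bar_shuffle_Cons_Cons:
  "bar_shuffle (a # as) (b # bs) =
    bar_cons a (bar_shuffle as (b # bs)) - frag_cmul ((-1) ^ length as) (bar_cons b (bar_shuffle (a # as) bs))"
  by (simp add: bar_cons_def flip: minus_frag_cmul)

declare bar_shuffle.simps(3) [simp del]

lemma bar_product_cons_cons:
  "bar_product (bar_cons a x) (bar_cons b y) =
    bar_cons a (bar_product x (bar_cons b y)) - bar_cons b (bar_product (bar_cons a (bar_sign x)) y)"
proof (induction x rule: frag_induct)
  case (one as)
  show ?case
    by (induction y rule: frag_induct)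
      (auto simp: bar_shuffle_Cons_Cons algebra_simps frag_cmul_distrib2)
qed (auto simp: algebra_simps)

lemma bar_sign_inner_faces:
  "bar_sign (inner_faces G gs) = - frag_cmul ((-1) ^ length gs) (inner_faces G gs)"
proof (induction gs)
  case (Cons a gs)
  have "length (mult_head G a gs) = length gs"
    by (cases gs) auto
  then show ?case
    by (cases "even (length gs)") (auto simp: Cons)
qed simp

text \<open>A word of the shuffle starts with the head of \<open>as\<close> or with
  \<open>b\<close>. The first kind is the whole shuffle of \<open>mult_head G a as\<close> with
  \<open>b # bs\<close> minus its words starting with \<open>b\<close>; the second kind gives the
  last term.\<close>

lemma bar_mult_head_shuffle_left:
  "bar_mult_head G a (bar_shuffle as (b # bs)) =
    bar_shuffle (mult_head G a as) (b # bs)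
    - frag_cmul ((-1) ^ length as) (bar_cons b (bar_shuffle (mult_head G a as) bs))
    + frag_cmul ((-1) ^ length as) (bar_cons (a \<otimes>\<^bsub>G\<^esub> b) (bar_shuffle as bs))"
  by (cases as; cases "even (length (tl as))") (auto simp: bar_shuffle_Cons_Cons)

lemma bar_mult_head_shuffle_right:
  "bar_mult_head G b (bar_shuffle (a # as) bs) =
    bar_shuffle (a # as) (mult_head G b bs) - bar_cons a (bar_shuffle as (mult_head G b bs))
    + bar_cons (b \<otimes>\<^bsub>G\<^esub> a) (bar_shuffle as bs)"
  by (cases bs) (auto simp: bar_shuffle_Cons_Cons)

text \<open>Faces that multiply two letters of the same factor give the right-hand side. Faces that
  multiply a letter of \<open>as\<close> with one of \<open>bs\<close> come in pairs, one for each
  order of the two letters, with opposite signs.\<close>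

lemma (in comm_monoid) bar_inner_shuffle:
  assumes "set as \<subseteq> carrier G" "set bs \<subseteq> carrier G"
  shows "bar_inner G (bar_shuffle as bs) =
    bar_product (inner_faces G as) (frag_of bs)
    + frag_cmul ((-1) ^ length as) (bar_product (frag_of as) (inner_faces G bs))"
  using assms
proof (induction as bs rule: bar_shuffle.induct)
  case (3 a as b bs)
  define s :: int where "s = (-1) ^ length as"
  have s: "s = 1 \<or> s = -1"
    by (cases "even (length as)") (auto simp: s_def)
  have IH1: "bar_inner G (bar_shuffle as (b # bs)) =
      bar_product (inner_faces G as) (frag_of (b # bs))
      + frag_cmul s (bar_product (frag_of as) (inner_faces G (b # bs)))"
    using 3 by (simp add: s_def)
  have IH2: "bar_inner G (bar_shuffle (a # as) bs) =
      bar_product (inner_faces G (a # as)) (frag_of bs)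
      - frag_cmul s (bar_product (frag_of (a # as)) (inner_faces G bs))"
    using 3 by (simp add: s_def flip: minus_frag_cmul)
  have 1: "bar_product (bar_cons a (inner_faces G as)) (frag_of (b # bs)) =
      bar_cons a (bar_product (inner_faces G as) (frag_of (b # bs)))
      + frag_cmul s (bar_cons b (bar_product (bar_cons a (inner_faces G as)) (frag_of bs)))"
    using bar_product_cons_cons[of a "inner_faces G as" b "frag_of bs"] s
    by (auto simp: bar_sign_inner_faces simp flip: s_def)
  have 2: "bar_product (frag_of (a # as)) (bar_cons b (inner_faces G bs)) =
      bar_cons a (bar_product (frag_of as) (bar_cons b (inner_faces G bs)))
      - frag_cmul s (bar_cons b (bar_product (frag_of (a # as)) (inner_faces G bs)))"
    using bar_product_cons_cons[of a "frag_of as" b "inner_faces G bs"] s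
    by (auto simp flip: s_def)
  \<comment> \<open>Commutativity makes the words starting with \<open>a \<otimes> b\<close> and
    with \<open>b \<otimes> a\<close> cancel.\<close>
  have comm: "b \<otimes> a = a \<otimes> b"
    using 3 by (simp add: m_comm)
  show ?case
    using s bar_mult_head_shuffle_left[of G a as b bs] bar_mult_head_shuffle_right[of G b a as bs]
    by (auto simp: bar_shuffle_Cons_Cons IH1 IH2 1 2 comm simp flip: s_def)
qed auto

lemma bar_tail_shuffle:
  "bar_tail (bar_shuffle as bs) =
    bar_product (bar_tail (frag_of as)) (frag_of bs)
    + frag_cmul ((-1) ^ length as) (bar_product (frag_of as) (bar_tail (frag_of bs)))"
  by (cases as; cases bs) (auto simp: bar_shuffle_Cons_Cons simp flip: minus_frag_cmul)

lemma (in comm_monoid) bar_boundary_shuffle: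
  assumes "set as \<subseteq> carrier G" "set bs \<subseteq> carrier G"
  shows "bar_boundary G (bar_shuffle as bs) =
    bar_product (bar_boundary G (frag_of as)) (frag_of bs)
    + frag_cmul ((-1) ^ length as) (bar_product (frag_of as) (bar_boundary G (frag_of bs)))"
  using bar_inner_shuffle[OF assms] bar_tail_shuffle[of as bs]
  by (simp add: bar_boundary_eq frag_cmul_distrib2)

section \<open>Homology classes\<close>

abbreviation bar_words :: "('a, 'b) monoid_scheme \<Rightarrow> nat \<Rightarrow> 'a list set" where
  "bar_words G n \<equiv> {gs. length gs = n \<and> set gs \<subseteq> carrier G}"

abbreviation bar_chains :: "('a, 'b) monoid_scheme \<Rightarrow> nat \<Rightarrow> ('a list \<Rightarrow>\<^sub>0 int) set" where
  "bar_chains G n \<equiv> carrier (bar_chain_group G n)"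

abbreviation bar_cycles :: "('a, 'b) monoid_scheme \<Rightarrow> nat \<Rightarrow> ('a list \<Rightarrow>\<^sub>0 int) set" where
  "bar_cycles G n \<equiv> carrier (bar_cycle_group G n)"

lemma bar_chains_iff: "x \<in> bar_chains G n \<longleftrightarrow> Poly_Mapping.keys x \<subseteq> bar_words G n"
  by (simp add: bar_chain_group_def)

lemma frag_of_in_bar_chains [simp]:
  "frag_of gs \<in> bar_chains G n \<longleftrightarrow> length gs = n \<and> set gs \<subseteq> carrier G"
  by (simp add: bar_chains_iff)

lemma bar_chains_closed [simp, intro]:
  "0 \<in> bar_chains G n"
  "x \<in> bar_chains G n \<Longrightarrow> - x \<in> bar_chains G n"
  "x \<in> bar_chains G n \<Longrightarrow> y \<in> bar_chains G n \<Longrightarrow> x + y \<in> bar_chains G n"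
  "x \<in> bar_chains G n \<Longrightarrow> y \<in> bar_chains G n \<Longrightarrow> x - y \<in> bar_chains G n"
  unfolding bar_chains_iff using keys_add[of x y] keys_diff[of x y] by simp_all blast+

lemma bar_chains_induct [consumes 1, case_names zero one diff]:
  assumes "x \<in> bar_chains G n" "P 0"
    and "\<And>gs. length gs = n \<Longrightarrow> set gs \<subseteq> carrier G \<Longrightarrow> P (frag_of gs)"
    and "\<And>x y. x \<in> bar_chains G n \<Longrightarrow> y \<in> bar_chains G n \<Longrightarrow> P x \<Longrightarrow> P y \<Longrightarrow> P (x - y)"
  shows "P x"
  using assms(1) unfolding bar_chains_iff
  by (rule free_Abelian_group_induct) (use assms in \<open>auto simp: bar_chains_iff\<close>)

lemma bar_cons_closed:
  assumes "x \<in> bar_chains G n" "a \<in> carrier G"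
  shows "bar_cons a x \<in> bar_chains G (Suc n)"
  using assms by (induction rule: bar_chains_induct) auto

lemma length_mult_head [simp]: "length (mult_head G a gs) = length gs"
  by (cases gs) auto

lemma (in monoid) inner_faces_closed:
  "set gs \<subseteq> carrier G \<Longrightarrow> inner_faces G gs \<in> bar_chains G (length gs - 1)"
proof (induction gs)
  case (Cons a gs)
  have "set (mult_head G a gs) \<subseteq> carrier G"
    using Cons.prems by (cases gs) auto
  moreover have "bar_cons a (inner_faces G gs) \<in> bar_chains G (length gs)"
    using Cons bar_cons_closed[of "inner_faces G gs" G "length gs - 1" a] by (cases gs) auto
  ultimately show ?case
    by (auto simp del: add_uminus_conv_diff)
qed simp

lemma (in monoid) bar_boundary_closed:
  assumes "x \<in> bar_chains G (Suc n)"
  shows "bar_boundary G x \<in> bar_chains G n"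
  using assms
proof (induction rule: bar_chains_induct)
  case (one gs)
  then show ?case
    using inner_faces_closed[of gs] by (cases gs) (auto simp: bar_boundary_frag_of)
qed auto

lemma (in monoid) bar_boundary_boundary:
  assumes "x \<in> bar_chains G n"
  shows "bar_boundary G (bar_boundary G x) = 0"
  using assms by (induction rule: bar_chains_induct) (auto simp: bar_boundary_boundary_frag_of)

lemma bar_cycles_iff: "z \<in> bar_cycles G n \<longleftrightarrow> z \<in> bar_chains G n \<and> bar_boundary G z = 0"
  by (simp add: bar_cycle_group_def)

lemma bar_cycle_group_simps [simp]:
  "x \<otimes>\<^bsub>bar_cycle_group G n\<^esub> y = x + y"
  "\<one>\<^bsub>bar_cycle_group G n\<^esub> = 0"
  by (simp_all add: bar_cycle_group_def bar_chain_group_def)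

lemma bar_boundaries_closed [simp, intro]:
  "0 \<in> bar_boundaries G n"
  "x \<in> bar_boundaries G n \<Longrightarrow> - x \<in> bar_boundaries G n"
  "x \<in> bar_boundaries G n \<Longrightarrow> y \<in> bar_boundaries G n \<Longrightarrow> x + y \<in> bar_boundaries G n"
proof -
  show "0 \<in> bar_boundaries G n"
    using imageI[of 0 "bar_chains G (Suc n)" "bar_boundary G"] by (simp add: bar_boundaries_def)
  show "- x \<in> bar_boundaries G n" if "x \<in> bar_boundaries G n"
    using that unfolding bar_boundaries_def by (force simp flip: bar_boundary_linear(4))
  show "x + y \<in> bar_boundaries G n" if "x \<in> bar_boundaries G n" "y \<in> bar_boundaries G n"
    using that unfolding bar_boundaries_def by (force simp flip: bar_boundary_linear(2))
qed

lemma bar_boundariesI: "x \<in> bar_chains G (Suc n) \<Longrightarrow> bar_boundary G x \<in> bar_boundaries G n"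
  by (simp add: bar_boundaries_def)

lemma (in monoid) bar_boundaries_subset_cycles: "bar_boundaries G n \<subseteq> bar_cycles G n"
  using bar_boundary_closed bar_boundary_boundary by (fastforce simp: bar_boundaries_def bar_cycles_iff)

lemma comm_group_bar_cycle_group: "comm_group (bar_cycle_group G n)"
proof (rule comm_groupI)
  fix x assume "x \<in> bar_cycles G n"
  then have "- x \<in> bar_cycles G n"
    by (simp add: bar_cycles_iff)
  then show "\<exists>y\<in>bar_cycles G n. y \<otimes>\<^bsub>bar_cycle_group G n\<^esub> x = \<one>\<^bsub>bar_cycle_group G n\<^esub>"
    by (intro bexI[of _ "- x"]) simp_all
qed (auto simp: bar_cycles_iff algebra_simps)

lemma (in monoid) bar_boundaries_normal: "bar_boundaries G n \<lhd> bar_cycle_group G n"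
proof -
  interpret Z: comm_group "bar_cycle_group G n"
    by (rule comm_group_bar_cycle_group)
  have "inv\<^bsub>bar_cycle_group G n\<^esub> x = - x" if "x \<in> bar_cycles G n" for x
    using that by (intro Z.inv_equality) (simp_all add: bar_cycles_iff)
  then have "inv\<^bsub>bar_cycle_group G n\<^esub> x \<in> bar_boundaries G n" if "x \<in> bar_boundaries G n" for x
    using that bar_boundaries_subset_cycles[of n] by auto
  then have "subgroup (bar_boundaries G n) (bar_cycle_group G n)"
    using bar_boundaries_subset_cycles by unfold_locales auto
  then show ?thesis
    by (rule Z.subgroup_imp_normal)
qed

lemma (in monoid) group_group_homology: "group (group_homology G n)"
  unfolding group_homology_def by (rule normal.factorgroup_is_group[OF bar_boundaries_normal])

lemma homology_class_eq: "homology_class G n z = {b + z |b. b \<in> bar_boundaries G n}"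
  by (auto simp: homology_class_def r_coset_def)

lemma homology_class_self: "z \<in> homology_class G n z"
  unfolding homology_class_eq by (rule CollectI, rule exI[of _ 0]) simp

lemma homology_class_eqI:
  assumes "z - z' \<in> bar_boundaries G n"
  shows "homology_class G n z = homology_class G n z'"
proof -
  have "homology_class G n z \<subseteq> homology_class G n z'" if "z - z' \<in> bar_boundaries G n" for z z'
  proof
    fix x assume "x \<in> homology_class G n z"
    then obtain b where "b \<in> bar_boundaries G n" "x = b + z"
      by (auto simp: homology_class_eq)
    moreover have "b + z = (b + (z - z')) + z'"
      by simp
    ultimately show "x \<in> homology_class G n z'"
      unfolding homology_class_eq using that by blast
  qed
  from this[OF assms] this[of z' z] show ?thesis
    using bar_boundaries_closed(2)[OF assms] by auto
qed

lemma homology_class_in_carrier: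
  "z \<in> bar_cycles G n \<Longrightarrow> homology_class G n z \<in> carrier (group_homology G n)"
  by (auto simp: group_homology_def homology_class_def FactGroup_def RCOSETS_def)

lemma group_homology_carrierE:
  assumes "X \<in> carrier (group_homology G n)"
  obtains z where "z \<in> bar_cycles G n" "X = homology_class G n z"
  using assms by (auto simp: group_homology_def homology_class_def FactGroup_def RCOSETS_def)

lemma group_homology_one: "\<one>\<^bsub>group_homology G n\<^esub> = bar_boundaries G n"
  by (simp add: group_homology_def FactGroup_def)

lemma group_homology_mult:
  "X \<otimes>\<^bsub>group_homology G n\<^esub> Y = {x + y |x y. x \<in> X \<and> y \<in> Y}"
  by (auto simp: group_homology_def FactGroup_def set_mult_def)

lemma the_elem_image_const: "c \<noteq> {} \<Longrightarrow> (\<And>x. x \<in> c \<Longrightarrow> f x = y) \<Longrightarrow> the_elem (f ` c) = y"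
  by (metis (mono_tags, lifting) image_cong image_constant_conv the_elem_eq)

subsection \<open>Functoriality\<close>

lemma bar_chain_map_closed:
  assumes "x \<in> bar_chains G n" "f \<in> hom G H"
  shows "bar_chain_map f x \<in> bar_chains H n"
  using assms by (induction rule: bar_chains_induct) (auto dest: hom_in_carrier)

lemma bar_chain_map_inner_faces:
  assumes "f \<in> hom G H" "set gs \<subseteq> carrier G"
  shows "bar_chain_map f (inner_faces G gs) = inner_faces H (map f gs)"
  using assms(2)
proof (induction gs)
  case (Cons a gs)
  have "map f (mult_head G a gs) = mult_head H (f a) (map f gs)"
    using Cons.prems hom_mult[OF assms(1)] by (cases gs) auto
  then show ?case
    using Cons by simp
qed simp

lemma bar_chain_map_boundary:
  assumes "x \<in> bar_chains G n" "f \<in> hom G H"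
  shows "bar_chain_map f (bar_boundary G x) = bar_boundary H (bar_chain_map f x)"
  using assms(1)
  by (induction rule: bar_chains_induct)
    (auto simp: bar_boundary_frag_of bar_chain_map_inner_faces[OF assms(2)] map_tl)

lemma bar_chain_map_cycle:
  "z \<in> bar_cycles G n \<Longrightarrow> f \<in> hom G H \<Longrightarrow> bar_chain_map f z \<in> bar_cycles H n"
  by (auto simp: bar_cycles_iff bar_chain_map_closed simp flip: bar_chain_map_boundary)

text \<open>The image under \<open>the_elem\<close> is a singleton, since the chain map sends
  boundaries to boundaries.\<close>

lemma homology_induced_class:
  assumes "f \<in> hom G H"
  shows "homology_induced H n f (homology_class G n z) = homology_class H n (bar_chain_map f z)"
  unfolding homology_induced_def
proof (rule the_elem_image_const)
  show "homology_class G n z \<noteq> {}"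
    using homology_class_self by blast
  fix x assume "x \<in> homology_class G n z"
  then obtain c where "c \<in> bar_chains G (Suc n)" "x = bar_boundary G c + z"
    by (auto simp: homology_class_eq bar_boundaries_def)
  then have "bar_chain_map f x - bar_chain_map f z \<in> bar_boundaries H n"
    using assms by (simp add: bar_chain_map_boundary bar_boundariesI bar_chain_map_closed)
  then show "homology_class H n (bar_chain_map f x) = homology_class H n (bar_chain_map f z)"
    by (rule homology_class_eqI)
qed

subsection \<open>Pontryagin products\<close>

lemma keys_bar_cons: "Poly_Mapping.keys (bar_cons a x) \<subseteq> (#) a ` Poly_Mapping.keys x"
  unfolding bar_cons_def using keys_frag_extend[of "\<lambda>gs. frag_of (a # gs)" x] by auto

lemma keys_bar_shuffle:
  "gs \<in> Poly_Mapping.keys (bar_shuffle as bs) \<Longrightarrow>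
    length gs = length as + length bs \<and> set gs = set as \<union> set bs"
proof (induction as bs arbitrary: gs rule: bar_shuffle.induct)
  case (3 a as b bs)
  have "gs \<in> Poly_Mapping.keys (bar_cons a (bar_shuffle as (b # bs))) \<union>
      Poly_Mapping.keys (bar_cons b (bar_shuffle (a # as) bs))"
    using 3(3) keys_diff unfolding bar_shuffle_Cons_Cons by fastforce
  then obtain hs where
    "gs = a # hs \<and> hs \<in> Poly_Mapping.keys (bar_shuffle as (b # bs)) \<or>
     gs = b # hs \<and> hs \<in> Poly_Mapping.keys (bar_shuffle (a # as) bs)"
    using keys_bar_cons by fastforce
  then show ?case
    using "3.IH" by auto
qed auto

lemma bar_product_closed:
  assumes "z \<in> bar_chains G p" "w \<in> bar_chains G q"
  shows "bar_product z w \<in> bar_chains G (p + q)"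
  using assms(1)
proof (induction rule: bar_chains_induct)
  case (one as)
  show ?case
    using assms(2)
  proof (induction rule: bar_chains_induct)
    case (one bs)
    then show ?case
      using \<open>length as = p\<close> \<open>set as \<subseteq> carrier G\<close> keys_bar_shuffle[of _ as bs]
      by (auto simp: bar_chains_iff)
  qed auto
qed auto

lemma (in comm_monoid) bar_boundary_product:
  assumes "z \<in> bar_chains G p" "w \<in> bar_chains G q"
  shows "bar_boundary G (bar_product z w) =
    bar_product (bar_boundary G z) w + frag_cmul ((-1) ^ p) (bar_product z (bar_boundary G w))"
  using assms(1)
proof (induction rule: bar_chains_induct)
  case (one as)
  show ?case
    using assms(2)
  proof (induction rule: bar_chains_induct)
    case (one bs)
    then show ?case
      using \<open>length as = p\<close> \<open>set as \<subseteq> carrier G\<close> by (simp add: bar_boundary_shuffle)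
  qed (auto simp: frag_cmul_diff_distrib2)
qed (auto simp: frag_cmul_diff_distrib2)

lemma (in comm_monoid) bar_product_cycle:
  assumes "z \<in> bar_cycles G p" "w \<in> bar_cycles G q"
  shows "bar_product z w \<in> bar_cycles G (p + q)"
  using assms bar_boundary_product[of z p w q] by (simp add: bar_cycles_iff bar_product_closed)

lemma (in comm_monoid) pontryagin_product_class:
  assumes z: "z \<in> bar_cycles G p" and w: "w \<in> bar_cycles G q"
  shows "pontryagin_product G p q (homology_class G p z) (homology_class G q w)
    = homology_class G (p + q) (bar_product z w)"
  unfolding pontryagin_product_def
proof (rule the_elem_image_const)
  show "homology_class G p z \<times> homology_class G q w \<noteq> {}"
    using homology_class_self by blast
  fix v assume "v \<in> homology_class G p z \<times> homology_class G q w"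
  then obtain c d where c: "c \<in> bar_chains G (Suc p)" and d: "d \<in> bar_chains G (Suc q)"
    and v: "v = (bar_boundary G c + z, bar_boundary G d + w)"
    by (auto simp: homology_class_eq bar_boundaries_def)
  have zw: "z \<in> bar_chains G p" "bar_boundary G z = 0" "w \<in> bar_chains G q" "bar_boundary G w = 0"
    using z w by (auto simp: bar_cycles_iff)
  define z' where "z' = bar_boundary G c + z"
  have z': "z' \<in> bar_chains G p" "bar_boundary G z' = 0"
    using zw c by (auto simp: z'_def bar_boundary_closed bar_boundary_boundary)
  \<comment> \<open>By the Leibniz rule the boundary of \<open>e\<close> is
    \<open>\<partial>c \<cdot> w + z' \<cdot> \<partial>d\<close>: the terms with
    \<open>\<partial>w\<close> and \<open>\<partial>z'\<close> vanish, and the scalar cancels the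
    sign of the second product. This is the difference of the two products.\<close>
  define e where "e = bar_product c w + frag_cmul ((-1) ^ p) (bar_product z' d)"
  have "bar_product z' d \<in> bar_chains G (Suc (p + q))"
    using bar_product_closed[OF z'(1) d] by simp
  then have "e \<in> bar_chains G (Suc (p + q))"
    using bar_product_closed[OF c zw(3)] by (cases "even p") (auto simp: e_def)
  moreover have "bar_product z' (bar_boundary G d + w) - bar_product z w = bar_boundary G e"
    using bar_boundary_product[OF c zw(3)] bar_boundary_product[OF z'(1) d] zw z'
    by (cases "even p") (auto simp: e_def, simp_all add: z'_def)
  ultimately have "bar_product z' (bar_boundary G d + w) - bar_product z w \<in> bar_boundaries G (p + q)"
    by (metis bar_boundariesI)
  then show "(case v of (z, w) \<Rightarrow> homology_class G (p + q) (bar_product z w))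
      = homology_class G (p + q) (bar_product z w)"
    unfolding v prod.case z'_def[symmetric] by (rule homology_class_eqI)
qed

text \<open>An explicit chain for the Pontryagin product of degree one classes; it is the signed sum
  of all orderings of the letters.\<close>

fun wedge_cycle :: "'a list \<Rightarrow> ('a list \<Rightarrow>\<^sub>0 int)" where
  "wedge_cycle [] = frag_of []"
| "wedge_cycle (a # as) = bar_product (frag_of [a]) (wedge_cycle as)"

lemma frag_of_singleton_cycle: "a \<in> carrier G \<Longrightarrow> frag_of [a] \<in> bar_cycles G (Suc 0)"
  by (simp add: bar_cycles_iff bar_boundary_frag_of)

lemma (in comm_monoid) wedge_cycle_cycle:
  "set as \<subseteq> carrier G \<Longrightarrow> wedge_cycle as \<in> bar_cycles G (length as)"
proof (induction as)
  case (Cons a as)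
  then show ?case
    using bar_product_cycle[of "frag_of [a]" 1 "wedge_cycle as" "length as"]
    by (simp add: frag_of_singleton_cycle)
qed (simp add: bar_cycles_iff bar_boundary_frag_of)

lemma (in comm_monoid) wedge_class_eq:
  "set as \<subseteq> carrier G \<Longrightarrow> wedge_class G as = homology_class G (length as) (wedge_cycle as)"
proof (induction as)
  case (Cons a as)
  then show ?case
    using pontryagin_product_class[of "frag_of [a]" 1 "wedge_cycle as" "length as"]
    by (simp add: frag_of_singleton_cycle wedge_cycle_cycle)
qed simp

text \<open>Enough about the support to see which factors of a cup product vanish, without writing
  the chain as a sum over permutations.\<close>

lemma keys_wedge_cycle:
  "gs \<in> Poly_Mapping.keys (wedge_cycle as) \<Longrightarrow> length gs = length as \<and> set gs = set as"
proof (induction as arbitrary: gs)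
  case (Cons a as)
  then obtain hs where "hs \<in> Poly_Mapping.keys (wedge_cycle as)"
    "gs \<in> Poly_Mapping.keys (bar_shuffle [a] hs)"
    using keys_frag_extend[of "bar_shuffle [a]" "wedge_cycle as"] by (auto simp: bar_product_def)
  then show ?case
    using Cons.IH keys_bar_shuffle by fastforce
qed simp

section \<open>Cup products of characters\<close>

definition frag_eval :: "('a \<Rightarrow> 'c::comm_ring_1) \<Rightarrow> ('a \<Rightarrow>\<^sub>0 int) \<Rightarrow> 'c" where
  "frag_eval h x = (\<Sum>k\<in>Poly_Mapping.keys x. of_int (Poly_Mapping.lookup x k) * h k)"

lemma frag_eval_superset:
  assumes "finite K" "Poly_Mapping.keys x \<subseteq> K"
  shows "frag_eval h x = (\<Sum>k\<in>K. of_int (Poly_Mapping.lookup x k) * h k)"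
  unfolding frag_eval_def using assms
  by (intro sum.mono_neutral_left) (auto simp: in_keys_iff)

lemma frag_eval_add: "frag_eval h (x + y) = frag_eval h x + frag_eval h y"
proof -
  let ?K = "Poly_Mapping.keys x \<union> Poly_Mapping.keys y"
  have "Poly_Mapping.keys (x + y) \<subseteq> ?K"
    by (rule keys_add)
  then show ?thesis
    by (simp add: frag_eval_superset[of ?K] lookup_add distrib_right sum.distrib)
qed

lemma frag_eval_linear [simp]:
  "frag_eval h 0 = 0"
  "frag_eval h (frag_of k) = h k"
  "frag_eval h (x + y) = frag_eval h x + frag_eval h y"
  "frag_eval h (- x) = - frag_eval h x"
  "frag_eval h (x - y) = frag_eval h x - frag_eval h y"
proof -
  show minus: "frag_eval h (- x) = - frag_eval h x" for x
    by (simp add: frag_eval_def sum_negf)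
  show "frag_eval h (x - y) = frag_eval h x - frag_eval h y"
    using frag_eval_add[of h x "- y"] by (simp add: minus)
qed (simp_all add: frag_eval_add, simp_all add: frag_eval_def)

lemma frag_eval_cong:
  "(\<And>k. k \<in> Poly_Mapping.keys x \<Longrightarrow> h k = h' k) \<Longrightarrow> frag_eval h x = frag_eval h' x"
  by (simp add: frag_eval_def)

lemma frag_eval_eq_0: "(\<And>k. k \<in> Poly_Mapping.keys x \<Longrightarrow> h k = 0) \<Longrightarrow> frag_eval h x = 0"
  by (simp add: frag_eval_def)

lemma frag_eval_extend: "frag_eval h (frag_extend f x) = frag_eval (\<lambda>k. frag_eval h (f k)) x"
  by (induction x rule: frag_induct) (auto simp: frag_extend_diff)

lemma frag_eval_cmul: "frag_eval (\<lambda>k. c * h k) x = c * frag_eval h x"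
  by (simp add: frag_eval_def sum_distrib_left mult_ac)

fun cup_product :: "('a \<Rightarrow> 'c::comm_ring_1) list \<Rightarrow> 'a list \<Rightarrow> 'c" where
  "cup_product [] [] = 1"
| "cup_product (\<phi> # \<phi>s) (g # gs) = \<phi> g * cup_product \<phi>s gs"
| "cup_product _ _ = 0"

lemma cup_product_cons:
  "frag_eval (cup_product (\<phi> # \<phi>s)) (bar_cons a x) = \<phi> a * frag_eval (cup_product \<phi>s) x"
  by (simp add: bar_cons_def frag_eval_extend frag_eval_cmul)

text \<open>On \<open>a # b # bs\<close> the zeroth face and the face multiplying \<open>a\<close>
  with \<open>b\<close> leave minus \<open>\<phi> a\<close> times the value on \<open>bs\<close>, by
  additivity of \<open>\<phi>\<close>. By induction the remaining faces contribute the
  opposite.\<close>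

lemma cup_product_cocycle:
  assumes "\<And>\<phi> a b. \<phi> \<in> set \<phi>s \<Longrightarrow> a \<in> carrier G \<Longrightarrow> b \<in> carrier G \<Longrightarrow> \<phi> (a \<otimes>\<^bsub>G\<^esub> b) = \<phi> a + \<phi> b"
    and "set gs \<subseteq> carrier G" "length gs = Suc (length \<phi>s)"
  shows "frag_eval (cup_product \<phi>s) (bar_boundary G (frag_of gs)) = 0"
  using assms
proof (induction \<phi>s arbitrary: gs)
  case Nil
  then obtain g where "gs = [g]"
    by (auto simp: length_Suc_conv)
  then show ?case
    by (simp add: bar_boundary_frag_of)
next
  case (Cons \<phi> \<phi>s)
  then obtain a b bs where gs: "gs = a # b # bs"
    by (auto simp: length_Suc_conv)
  have "frag_eval (cup_product \<phi>s) (bar_boundary G (frag_of (b # bs))) = 0"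
    using Cons.prems by (intro Cons.IH) (auto simp: gs)
  then have "frag_eval (cup_product \<phi>s) (inner_faces G (b # bs)) = - cup_product \<phi>s bs"
    by (simp add: bar_boundary_frag_of eq_neg_iff_add_eq_0 add.commute del: inner_faces.simps)
  then show ?case
    using Cons.prems(1)[of \<phi> a b] Cons.prems(2)
    by (simp add: gs bar_boundary_frag_of cup_product_cons algebra_simps del: inner_faces.simps(2)
        add: inner_faces.simps(2)[of G a])
qed

lemma cup_product_boundary:
  assumes "\<And>\<phi> a b. \<phi> \<in> set \<phi>s \<Longrightarrow> a \<in> carrier G \<Longrightarrow> b \<in> carrier G \<Longrightarrow> \<phi> (a \<otimes>\<^bsub>G\<^esub> b) = \<phi> a + \<phi> b"
    and "x \<in> bar_boundaries G (length \<phi>s)"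
  shows "frag_eval (cup_product \<phi>s) x = 0"
proof -
  obtain c where c: "c \<in> bar_chains G (Suc (length \<phi>s))" "x = bar_boundary G c"
    using assms(2) by (auto simp: bar_boundaries_def)
  from c(1) have "frag_eval (cup_product \<phi>s) (bar_boundary G c) = 0"
    by (induction rule: bar_chains_induct) (auto intro: cup_product_cocycle assms(1))
  then show ?thesis
    by (simp add: c)
qed

lemma cup_product_map: "cup_product \<phi>s (map f gs) = cup_product (map (\<lambda>\<phi>. \<phi> \<circ> f) \<phi>s) gs"
proof (induction \<phi>s arbitrary: gs)
  case Nil
  then show ?case
    by (cases gs) auto
next
  case (Cons \<phi> \<phi>s)
  then show ?case
    by (cases gs) auto
qed

lemma cup_product_chain_map:
  "frag_eval (cup_product \<phi>s) (bar_chain_map f x) = frag_eval (cup_product (map (\<lambda>\<phi>. \<phi> \<circ> f) \<phi>s)) x"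
  by (simp add: bar_chain_map_def frag_eval_extend cup_product_map)

lemma cup_product_eq_0:
  "g \<in> set gs \<Longrightarrow> \<forall>\<phi>\<in>set \<phi>s. \<phi> g = 0 \<Longrightarrow> cup_product \<phi>s gs = 0"
  by (induction \<phi>s gs rule: cup_product.induct) auto

text \<open>Of the words obtained by inserting \<open>a\<close>, only the one with \<open>a\<close>
  in front survives, since otherwise \<open>\<phi>\<close> is evaluated at a letter of
  \<open>as\<close>.\<close>

lemma cup_product_wedge_Cons:
  assumes "\<And>g. g \<in> set as \<Longrightarrow> \<phi> g = 0"
  shows "frag_eval (cup_product (\<phi> # \<phi>s)) (wedge_cycle (a # as))
    = \<phi> a * frag_eval (cup_product \<phi>s) (wedge_cycle as)"
proof -
  have "frag_eval (cup_product (\<phi> # \<phi>s)) (bar_shuffle [a] gs) = \<phi> a * cup_product \<phi>s gs"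
    if "gs \<in> Poly_Mapping.keys (wedge_cycle as)" for gs
  proof (cases gs)
    case (Cons b bs)
    then have "\<phi> b = 0"
      using keys_wedge_cycle[OF that] assms by auto
    then show ?thesis
      by (simp add: Cons bar_shuffle_Cons_Cons cup_product_cons)
  qed simp
  then have "frag_eval (\<lambda>gs. frag_eval (cup_product (\<phi> # \<phi>s)) (bar_shuffle [a] gs)) (wedge_cycle as)
      = frag_eval (\<lambda>gs. \<phi> a * cup_product \<phi>s gs) (wedge_cycle as)"
    by (rule frag_eval_cong)
  then show ?thesis
    by (simp add: bar_product_def frag_eval_extend frag_eval_cmul)
qed

text \<open>For increasing index lists the determinant of pairings is a Kronecker delta, since all terms
  but the diagonal one contain a vanishing factor.\<close>

lemma cup_product_wedge_dual:
  fixes \<phi> :: "nat \<Rightarrow> 'a \<Rightarrow> 'c::comm_ring_1" and e :: "nat \<Rightarrow> 'a"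
  assumes dual: "\<And>l m. \<phi> l (e m) = (if l = m then 1 else 0)"
    and "sorted_wrt (<) ls" "sorted_wrt (<) ms" "length ls = length ms"
  shows "frag_eval (cup_product (map \<phi> ls)) (wedge_cycle (map e ms)) = (if ls = ms then 1 else 0)"
  using assms(2-)
proof (induction ls arbitrary: ms)
  case (Cons l ls)
  then obtain m ms' where ms: "ms = m # ms'"
    by (cases ms) auto
  consider "l < m" | "m < l" | "l = m"
    by linarith
  then show ?case
  proof cases
    case 1
    \<comment> \<open>All indices in \<open>ms\<close> exceed \<open>l\<close>, so the first factor
      \<open>\<phi> l\<close> vanishes on the first letter of every word.\<close>
    have "cup_product (map \<phi> (l # ls)) gs = 0"
      if gs: "gs \<in> Poly_Mapping.keys (wedge_cycle (map e ms))" for gs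
    proof -
      obtain g gs' where "gs = g # gs'"
        using keys_wedge_cycle[OF gs] by (cases gs) (auto simp: ms)
      moreover obtain m' where "m' \<in> set ms" "g = e m'"
        using keys_wedge_cycle[OF gs] \<open>gs = g # gs'\<close> by auto
      ultimately show ?thesis
        using 1 Cons.prems(2) by (auto simp: dual ms)
    qed
    then show ?thesis
      using 1 by (simp add: frag_eval_eq_0 ms)
  next
    case 2
    \<comment> \<open>The letter \<open>e m\<close> occurs in every word, and all characters vanish
      on it because their indices exceed \<open>m\<close>.\<close>
    have "cup_product (map \<phi> (l # ls)) gs = 0"
      if gs: "gs \<in> Poly_Mapping.keys (wedge_cycle (map e ms))" for gs
      using keys_wedge_cycle[OF gs] 2 Cons.prems(1)
      by (intro cup_product_eq_0[of "e m"]) (auto simp: ms dual)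
    then show ?thesis
      using 2 by (simp add: frag_eval_eq_0 ms)
  next
    case 3
    have "frag_eval (cup_product (\<phi> l # map \<phi> ls)) (wedge_cycle (e m # map e ms'))
        = \<phi> l (e m) * frag_eval (cup_product (map \<phi> ls)) (wedge_cycle (map e ms'))"
      using Cons.prems(2) 3 by (intro cup_product_wedge_Cons) (auto simp: ms dual)
    then show ?thesis
      using 3 Cons.IH[of ms'] Cons.prems by (simp add: ms dual del: wedge_cycle.simps)
  qed
qed simp

section \<open>The groups\<close>

lemma monoid_SL2: "monoid (SL2 :: ('a::comm_ring_1 ^ 2 ^ 2) monoid)"
  by (rule monoidI) (auto simp: SL2_def det_mul matrix_mul_assoc)

lemma group_GL2: "group (GL2 :: ('a::comm_ring_1 ^ 2 ^ 2) monoid)"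
proof (rule groupI)
  fix A :: "'a ^ 2 ^ 2"
  assume "A \<in> carrier GL2"
  then show "\<exists>B\<in>carrier GL2. B \<otimes>\<^bsub>GL2\<^esub> A = \<one>\<^bsub>GL2\<^esub>"
    by (auto simp: GL2_def invertible_def)
qed (auto simp: GL2_def invertible_mult matrix_mul_assoc invertible_def[of "mat 1"])

lemma det_elementary_matrix: "r \<noteq> s \<Longrightarrow> det (elementary_matrix r s a) = 1"
  using exhaust_2[of r] exhaust_2[of s] by (auto simp: det_2 elementary_matrix_def)

lemma elementary_matrix_mult:
  "r \<noteq> s \<Longrightarrow> elementary_matrix r s a ** elementary_matrix r s b = elementary_matrix r s (a + b)"
  using exhaust_2[of r] exhaust_2[of s]
  by (auto simp: elementary_matrix_def matrix_matrix_mult_def vec_eq_iff forall_2 sum_2)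

lemma elementary_matrix_0: "elementary_matrix r s 0 = mat 1"
  by (simp add: elementary_matrix_def mat_def vec_eq_iff)

lemma elementary_matrix_in_GL2: "r \<noteq> s \<Longrightarrow> elementary_matrix r s a \<in> carrier GL2"
  using elementary_matrix_mult[of r s a "- a"] elementary_matrix_mult[of r s "- a" a]
  by (auto simp: GL2_def invertible_def elementary_matrix_0)

lemma E2_simps [simp]:
  "A \<otimes>\<^bsub>E2\<^esub> B = A ** B"
  "\<one>\<^bsub>E2\<^esub> = mat 1"
  by (simp_all add: E2_def GL2_def)

lemma E2_carrier_subset: "carrier E2 \<subseteq> carrier (SL2 :: ('a::comm_ring_1 ^ 2 ^ 2) monoid)"
proof
  fix M :: "'a ^ 2 ^ 2"
  assume "M \<in> carrier E2"
  then have "M \<in> generate GL2 {elementary_matrix r s a |r s a. r \<noteq> s}"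
    by (simp add: E2_def)
  then have "det M = 1"
  proof (induction rule: generate.induct)
    \<comment> \<open>\<open>generate\<close> also admits inverses of generators, whose determinant
      follows from \<open>h ** inv h = 1\<close>.\<close>
    case (inv h)
    then have "h \<in> carrier GL2" "det h = 1"
      by (auto simp: elementary_matrix_in_GL2 det_elementary_matrix)
    then have "h ** inv\<^bsub>GL2\<^esub> h = mat 1"
      using group.r_inv[OF group_GL2, of h] by (simp add: GL2_def)
    then have "det h * det (inv\<^bsub>GL2\<^esub> h) = 1"
      by (metis det_mul det_I)
    then show ?case
      using \<open>det h = 1\<close> by simp
  qed (auto simp: GL2_def det_mul det_elementary_matrix)
  then show "M \<in> carrier SL2"
    by (simp add: SL2_def)
qed

lemma inclusion_hom: "(\<lambda>M. M) \<in> hom E2 (SL2 :: ('a::comm_ring_1 ^ 2 ^ 2) monoid)"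
  using E2_carrier_subset by (auto simp: hom_def SL2_def)

lemma upper_unipotent_hom: "upper_unipotent \<in> hom tZt E2"
proof -
  have "upper_unipotent f \<in> carrier E2" for f
    unfolding E2_def upper_unipotent_def
    by simp (rule generate.incl, rule CollectI, intro exI conjI, rule refl, simp)
  then show ?thesis
    by (auto simp: hom_def tZt_def upper_unipotent_def elementary_matrix_mult)
qed

lemma comm_monoid_tZt: "comm_monoid tZt"
  by (rule comm_monoidI) (auto simp: tZt_def algebra_simps)

section \<open>Pairing the characters with the classes of the tuples\<close>

definition SL2_cycle :: "nat list \<Rightarrow> ((int poly ^ 2 ^ 2) list \<Rightarrow>\<^sub>0 int)" where
  "SL2_cycle ls = bar_chain_map (\<lambda>M. M)
    (bar_chain_map upper_unipotent (wedge_cycle (map (\<lambda>l. monom 1 l) ls)))"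

lemma SL2_class_eq:
  assumes "ls \<in> exponent_tuples i"
  shows "SL2_class ls = homology_class SL2 i (SL2_cycle ls)" and "SL2_cycle ls \<in> bar_cycles SL2 i"
proof -
  have len: "length ls = i"
    using assms by (simp add: exponent_tuples_def)
  have carrier: "set (map (\<lambda>l. monom 1 l) ls) \<subseteq> carrier tZt"
    using assms by (auto simp: exponent_tuples_def tZt_def)
  show "SL2_class ls = homology_class SL2 i (SL2_cycle ls)"
    using comm_monoid.wedge_class_eq[OF comm_monoid_tZt carrier]
    by (simp add: SL2_class_def E2_class_def SL2_cycle_def len
        homology_induced_class[OF upper_unipotent_hom] homology_induced_class[OF inclusion_hom])
  show "SL2_cycle ls \<in> bar_cycles SL2 i"
    using comm_monoid.wedge_cycle_cycle[OF comm_monoid_tZt carrier] unfolding SL2_cycle_def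
    by (intro bar_chain_map_cycle[OF _ inclusion_hom] bar_chain_map_cycle[OF _ upper_unipotent_hom])
      (simp add: len)
qed

text \<open>Pulled back along \<open>upper_unipotent\<close>, the characters become the coefficient
  functionals, which are dual to the monomials.\<close>

lemma frag_eval_SL2_cycle:
  assumes "ls \<in> exponent_tuples i" "ms \<in> exponent_tuples i"
  shows "frag_eval (cup_product (map SL2_character ls)) (SL2_cycle ms) = (if ls = ms then 1 else 0)"
proof -
  have "frag_eval (cup_product (map (\<lambda>l f. rat_of_int (coeff f l)) ls))
      (wedge_cycle (map (\<lambda>l. monom 1 l) ms)) = (if ls = ms then 1 else 0)"
    using assms by (intro cup_product_wedge_dual) (auto simp: exponent_tuples_def)
  then show ?thesis
    by (simp add: SL2_cycle_def cup_product_chain_map comp_def SL2_character_upper_unipotent)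
qed

lemma frag_eval_SL2_boundary:
  assumes "ls \<in> exponent_tuples i" "x \<in> bar_boundaries SL2 i"
  shows "frag_eval (cup_product (map SL2_character ls)) x = 0"
  using assms
  by (intro cup_product_boundary[where G = SL2]) (auto simp: exponent_tuples_def SL2_character_mult)

lemma frag_eval_SL2_class:
  assumes "ls \<in> exponent_tuples i" "x \<in> homology_class SL2 i z"
  shows "frag_eval (cup_product (map SL2_character ls)) x = frag_eval (cup_product (map SL2_character ls)) z"
  using assms by (auto simp: homology_class_eq frag_eval_SL2_boundary)

section \<open>Failure of finite generation and the final statement\<close>

lemma SL2_characters_vanish:
  assumes "finite T"
  shows "\<exists>N. \<forall>l\<ge>N. \<forall>M\<in>T. SL2_character l M = 0"
  using assms
proof induction
  case (insert M T)
  then obtain N N' where "\<forall>l\<ge>N. \<forall>M\<in>T. SL2_character l M = 0" "\<forall>l\<ge>N'. SL2_character l M = 0"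
    using SL2_character_eventually_zero by blast
  then show ?case
    by (intro exI[of _ "max N N'"]) auto
qed auto

theorem SL2_homology_not_finitely_generated:
  assumes "i \<ge> 1"
  shows "\<not> finitely_generated (group_homology (SL2 :: (int poly ^ 2 ^ 2) monoid) i)"
proof
  let ?H = "group_homology (SL2 :: (int poly ^ 2 ^ 2) monoid) i"
  interpret H: group ?H
    by (rule monoid.group_group_homology[OF monoid_SL2])
  assume "finitely_generated ?H"
  then obtain X where X: "finite X" "X \<subseteq> carrier ?H" "generate ?H X = carrier ?H"
    by (auto simp: finitely_generated_def)
  have "\<forall>c\<in>X. \<exists>z. z \<in> bar_cycles SL2 i \<and> homology_class SL2 i z = c"
  proof
    fix c assume "c \<in> X"
    then have "c \<in> carrier ?H"
      using X(2) by blast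
    then show "\<exists>z. z \<in> bar_cycles SL2 i \<and> homology_class SL2 i z = c"
      by (rule group_homology_carrierE) blast
  qed
  from bchoice[OF this] obtain z
    where "\<forall>c\<in>X. z c \<in> bar_cycles SL2 i \<and> homology_class SL2 i (z c) = c" ..
  then have z: "\<And>c. c \<in> X \<Longrightarrow> z c \<in> bar_cycles SL2 i"
    and class_z: "\<And>c. c \<in> X \<Longrightarrow> homology_class SL2 i (z c) = c"
    by simp_all
  \<comment> \<open>All matrices that occur in the chosen representatives of the finitely many
    generators.\<close>
  define T where "T = (\<Union>c\<in>X. \<Union>gs\<in>Poly_Mapping.keys (z c). set gs)"
  have "finite T"
    unfolding T_def using X(1) by simp
  from SL2_characters_vanish[OF this] obtain N
    where "\<forall>l\<ge>N. \<forall>M\<in>T. SL2_character l M = 0" ..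
  then have N: "\<And>l M. l \<ge> N \<Longrightarrow> M \<in> T \<Longrightarrow> SL2_character l M = 0"
    by simp
  \<comment> \<open>Starting at \<open>Suc N\<close> makes every index at least 1, as tuples
    require, and large enough for the characters to vanish on \<open>T\<close>.\<close>
  define ls where "ls = [Suc N..<Suc N + i]"
  have ls: "ls \<in> exponent_tuples i"
    by (simp add: ls_def exponent_tuples_def del: upt_Suc)
  let ?e = "frag_eval (cup_product (map SL2_character ls))"
  have e_z: "?e (z c) = 0" if "c \<in> X" for c
  proof (rule frag_eval_eq_0)
    fix gs assume gs: "gs \<in> Poly_Mapping.keys (z c)"
    then have "length gs = i"
      using z[OF that] by (auto simp: bar_cycles_iff bar_chains_iff)
    \<comment> \<open>Since \<open>i \<ge> 1\<close>, every word has a letter, and that letter lies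
      in \<open>T\<close>.\<close>
    then have "hd gs \<in> set gs"
      using assms by (cases gs) auto
    moreover from this have "hd gs \<in> T"
      using gs that by (auto simp: T_def)
    ultimately show "cup_product (map SL2_character ls) gs = 0"
      by (intro cup_product_eq_0[of "hd gs"]) (auto simp: ls_def N)
  qed
  have e_gen: "?e x = 0" if "c \<in> X" "x \<in> c" for c x
    using frag_eval_SL2_class[OF ls, of x "z c"] class_z e_z that by simp
  \<comment> \<open>The claim covers all chains in the coset, so a product, being the set of sums,
    is handled by additivity.\<close>
  have e_0: "?e x = 0" if "c \<in> generate ?H X" "x \<in> c" for c x
    using that
  proof (induction arbitrary: x rule: generate.induct)
    case one
    then show ?case
      using frag_eval_SL2_boundary[OF ls] by (simp add: group_homology_one)
  next
    case (incl c)
    then show ?case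
      by (rule e_gen)
  next
    case (inv c)
    have c: "c \<in> carrier ?H"
      using inv(1) X(2) by (rule rev_subsetD)
    have "z c \<in> c"
      using homology_class_self[of "z c" SL2 i] unfolding class_z[OF inv(1)] .
    \<comment> \<open>A chain in the inverse class plus the representative of \<open>c\<close> is a
      boundary, where the cup product vanishes.\<close>
    then have "z c + x \<in> c \<otimes>\<^bsub>?H\<^esub> inv\<^bsub>?H\<^esub> c"
      unfolding group_homology_mult using inv(2) by blast
    then have "z c + x \<in> bar_boundaries SL2 i"
      unfolding H.r_inv[OF c] group_homology_one .
    then have "?e (z c + x) = 0"
      by (rule frag_eval_SL2_boundary[OF ls])
    then show ?case
      using e_z[OF inv(1)] by simp
  next
    case (eng c d)
    then show ?case
      by (auto simp: group_homology_mult)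
  qed
  have "SL2_class ls \<in> generate ?H X"
    unfolding X(3) SL2_class_eq(1)[OF ls] by (intro homology_class_in_carrier SL2_class_eq(2)[OF ls])
  moreover have "SL2_cycle ls \<in> SL2_class ls"
    unfolding SL2_class_eq(1)[OF ls] by (rule homology_class_self)
  ultimately have "?e (SL2_cycle ls) = 0"
    by (rule e_0)
  then show False
    using frag_eval_SL2_cycle[OF ls ls] by simp
qed

theorem theorem5p2:
  fixes i :: nat
  assumes "i \<ge> 1"
  shows "(\<forall>ls \<in> exponent_tuples i.
            SL2_class ls \<in> carrier (group_homology SL2 i) \<and>
            SL2_class ls \<noteq> \<one>\<^bsub>group_homology SL2 i\<^esub>) \<and>
         (\<forall>ls \<in> exponent_tuples i. \<forall>ms \<in> exponent_tuples i.
            ls \<noteq> ms \<longrightarrow> SL2_class ls \<noteq> SL2_class ms) \<and>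
         \<not> finitely_generated (group_homology (SL2 :: (int poly ^ 2 ^ 2) monoid) i)"
proof (intro conjI ballI impI)
  fix ls assume ls: "ls \<in> exponent_tuples i"
  have self: "SL2_cycle ls \<in> SL2_class ls"
    unfolding SL2_class_eq(1)[OF ls] by (rule homology_class_self)
  show "SL2_class ls \<in> carrier (group_homology SL2 i)"
    unfolding SL2_class_eq(1)[OF ls] by (intro homology_class_in_carrier SL2_class_eq(2)[OF ls])
  \<comment> \<open>The cup product indexed by \<open>ls\<close> is 1 on the cycle of
    \<open>ls\<close> but 0 on every boundary. It also separates this cycle from those of other
    tuples below.\<close>
  show "SL2_class ls \<noteq> \<one>\<^bsub>group_homology SL2 i\<^esub>"
    using self frag_eval_SL2_boundary[OF ls, of "SL2_cycle ls"] frag_eval_SL2_cycle[OF ls ls]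
    by (auto simp: group_homology_one)
  fix ms assume ms: "ms \<in> exponent_tuples i" and "ls \<noteq> ms"
  show "SL2_class ls \<noteq> SL2_class ms"
  proof
    assume "SL2_class ls = SL2_class ms"
    then have "SL2_cycle ls \<in> homology_class SL2 i (SL2_cycle ms)"
      using self SL2_class_eq(1)[OF ms] by simp
    from frag_eval_SL2_class[OF ls this] show False
      using \<open>ls \<noteq> ms\<close> by (simp add: frag_eval_SL2_cycle[OF ls] ls ms)
  qed
qed (rule SL2_homology_not_finitely_generated[OF assms])

end
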